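(* The spectrum of the self-adjoint operator $L_n$ on $L^2(\mu_n)$ contains $$\Bigl\{-2\frac{\alpha_n}{n}k:k\in\mathbb{N}\Bigr\}.$$
   Context: $n\ge1$ is an integer, $\mathbb{N}=\{0,1,2,\ldots\}$, $\mathbb{C}^n\equiv\mathbb{R}^{2n}$, $\alpha_n>0$ is fixed and $\beta_n=n^2$. $\mu_n$ is the probability measure $\mathrm{d}\mu_n(z)=\frac1{c_n}\mathrm{e}^{-n\sum_k|z_k|^2}\prod_{j<k}|z_j-z_k|^2\,\mathrm{d}z$ on $\mathbb{C}^n$ ($c_n$ normalizing constant), and $L^2(\mu_n)$ is the space of complex-valued square-integrable classes. $H^1(\mu_n)$ is the closure (completion) of $\mathcal{C}^\infty_c(\mathbb{C}^n,\mathbb{C})$ for the norm $(\|f\|^2_{L^2(\mu_n)}+\|\nabla f\|^2_{L^2(\mu_n)})^{1/2}$, viewed as a subspace of $L^2(\mu_n)$, where $\nabla$ is the Euclidean gradient on $\mathbb{R}^{2n}$ extended complex-linearly. The form $\mathcal{E}_n(f,g)=\frac{\alpha_n}{\beta_n}\int_{\mathbb{C}^n}\nabla f\cdot\overline{\nabla g}\,\mathrm{d}\mu_n$ with domain $H^1(\mu_n)$ is closed, nonnegative and Hermitian. $L_n$ is the associated (nonpositive, self-adjoint) operator: its domain $\mathcal{D}(L_n)$ is the set of $f\in H^1(\mu_n)$ for which there is $a\in L^2(\mu_n)$ with $-\langle a,\varphi\rangle_{L^2(\mu_n)}=\mathcal{E}_n(f,\varphi)$ for all $\varphi\in H^1(\mu_n)$,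 and then $L_nf=a$. *)

theory Defs
  imports "HOL-Analysis.Analysis"
begin

section \<open>Complex-valued square-integrable functions\<close>

text \<open>Elements of \<open>L\<^sup>2(M)\<close> are represented by measurable square-integrable functions;
  equality of classes is equality almost everywhere.\<close>

definition L2 :: "'a measure \<Rightarrow> ('a \<Rightarrow> complex) set" where
  "L2 M = {f \<in> borel_measurable M. integrable M (\<lambda>x. (cmod (f x))\<^sup>2)}"

definition L2_norm :: "'a measure \<Rightarrow> ('a \<Rightarrow> complex) \<Rightarrow> real" where
  "L2_norm M f = sqrt (\<integral>x. (cmod (f x))\<^sup>2 \<partial>M)"

definition L2_inner :: "'a measure \<Rightarrow> ('a \<Rightarrow> complex) \<Rightarrow> ('a \<Rightarrow> complex) \<Rightarrow> complex" where
  "L2_inner M f g = (\<integral>x. f x * cnj (g x) \<partial>M)"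

text \<open>An unbounded operator on \<open>L\<^sup>2(M)\<close> is given by its domain \<open>D\<close> and its action \<open>T\<close> on
  representatives. The three conditions say that \<open>\<zeta> - T\<close>, from \<open>D\<close> to \<open>L\<^sup>2(M)\<close>, is injective
  and surjective on classes, with bounded inverse.\<close>

definition resolvent_set ::
    "'a measure \<Rightarrow> ('a \<Rightarrow> complex) set \<Rightarrow> (('a \<Rightarrow> complex) \<Rightarrow> ('a \<Rightarrow> complex)) \<Rightarrow> complex set" where
  "resolvent_set M D T = {\<zeta>.
     (\<forall>f\<in>D. \<forall>g\<in>D. (AE x in M. \<zeta> * f x - T f x = \<zeta> * g x - T g x) \<longrightarrow> (AE x in M. f x = g x)) \<and>
     (\<forall>h\<in>L2 M. \<exists>f\<in>D. AE x in M. \<zeta> * f x - T f x = h x) \<and>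
     (\<exists>C. \<forall>f\<in>D. L2_norm M f \<le> C * L2_norm M (\<lambda>x. \<zeta> * f x - T f x))}"

definition spectrum ::
    "'a measure \<Rightarrow> ('a \<Rightarrow> complex) set \<Rightarrow> (('a \<Rightarrow> complex) \<Rightarrow> ('a \<Rightarrow> complex)) \<Rightarrow> complex set" where
  "spectrum M D T = - resolvent_set M D T"


section \<open>Test functions and the space \<open>H\<^sup>1\<close>\<close>

text \<open>The gradient of a complex-valued function on a real Euclidean space is the family of its
  partial derivatives, indexed by the vectors of the orthonormal basis \<open>Basis\<close>. For
  \<open>complex ^ 'n\<close> these are \<open>axis j 1\<close> and \<open>axis j \<i>\<close>, so this is the gradient on
  \<open>\<real>\<^sup>2\<^sup>n\<close>. Values of a vector field at indices outside \<open>Basis\<close> are irrelevant.\<close>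

definition grad :: "('a::euclidean_space \<Rightarrow> complex) \<Rightarrow> 'a \<Rightarrow> 'a \<Rightarrow> complex" where
  "grad f b x = frechet_derivative f (at x) b"

primrec k_times_differentiable :: "nat \<Rightarrow> ('a::euclidean_space \<Rightarrow> complex) \<Rightarrow> bool" where
  "k_times_differentiable 0 f \<longleftrightarrow> continuous_on UNIV f"
| "k_times_differentiable (Suc k) f \<longleftrightarrow>
     (\<forall>x. f differentiable (at x)) \<and> (\<forall>b\<in>Basis. k_times_differentiable k (grad f b))"

definition test_functions :: "('a::euclidean_space \<Rightarrow> complex) set" where
  "test_functions =
     {f. (\<forall>k. k_times_differentiable k f) \<and> compact (closure {x. f x \<noteq> 0})}"

text \<open>The pair \<open>(f, G)\<close> is a limit of pairs \<open>(\<phi>, \<nabla>\<phi>)\<close>, for test functions \<open>\<phi>\<close>, in the norm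
  of \<open>H\<^sup>1(M)\<close>. If, as for the measure below, the gradient is closable in \<open>L\<^sup>2(M)\<close>, then \<open>f\<close>
  determines \<open>G\<close> almost everywhere, and the completion is the subspace \<open>H1 M\<close> of \<open>L\<^sup>2(M)\<close>.\<close>

definition has_H1_gradient ::
    "'a::euclidean_space measure \<Rightarrow> ('a \<Rightarrow> complex) \<Rightarrow> ('a \<Rightarrow> 'a \<Rightarrow> complex) \<Rightarrow> bool" where
  "has_H1_gradient M f G \<longleftrightarrow>
     f \<in> L2 M \<and> (\<forall>b\<in>Basis. G b \<in> L2 M) \<and>
     (\<exists>\<phi>. (\<forall>i::nat. \<phi> i \<in> test_functions) \<and>
       (\<lambda>i. sqrt ((L2_norm M (\<lambda>x. \<phi> i x - f x))\<^sup>2 +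
                  (\<Sum>b\<in>Basis. (L2_norm M (\<lambda>x. grad (\<phi> i) b x - G b x))\<^sup>2))) \<longlonglongrightarrow> 0)"

definition H1 :: "'a::euclidean_space measure \<Rightarrow> ('a \<Rightarrow> complex) set" where
  "H1 M = {f. \<exists>G. has_H1_gradient M f G}"

definition H1_grad :: "'a::euclidean_space measure \<Rightarrow> ('a \<Rightarrow> complex) \<Rightarrow> 'a \<Rightarrow> 'a \<Rightarrow> complex" where
  "H1_grad M f = (SOME G. has_H1_gradient M f G)"


section \<open>The measure, the Dirichlet form and its operator\<close>

text \<open>The dimension \<open>n\<close> is \<open>CARD('n)\<close>; the order on the index type only serves to write the
  product over \<open>j < k\<close>.\<close>

definition gas_weight :: "complex ^ 'n::{finite,linorder} \<Rightarrow> real" where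
  "gas_weight z = exp (- real CARD('n) * (\<Sum>k\<in>UNIV. (cmod (z $ k))\<^sup>2)) *
     (\<Prod>(j, k)\<in>{(j, k). j < k}. (cmod (z $ j - z $ k))\<^sup>2)"

definition gas_measure :: "(complex ^ 'n::{finite,linorder}) measure" where
  "gas_measure =
     density lborel (\<lambda>z. ennreal (gas_weight z / (\<integral>w. gas_weight (w :: complex ^ 'n::{finite,linorder}) \<partial>lborel)))"

definition dirichlet_form ::
    "real \<Rightarrow> (complex ^ 'n::{finite,linorder} \<Rightarrow> complex) \<Rightarrow> (complex ^ 'n::{finite,linorder} \<Rightarrow> complex) \<Rightarrow> complex" where
  "dirichlet_form \<alpha> f g = complex_of_real (\<alpha> / (real CARD('n))\<^sup>2) *
     (\<integral>z. (\<Sum>b\<in>Basis. H1_grad gas_measure f b z * cnj (H1_grad gas_measure g b z)) \<partial>gas_measure)"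

definition is_generator_value ::
    "real \<Rightarrow> (complex ^ 'n::{finite,linorder} \<Rightarrow> complex) \<Rightarrow> (complex ^ 'n::{finite,linorder} \<Rightarrow> complex) \<Rightarrow> bool" where
  "is_generator_value \<alpha> f a \<longleftrightarrow>
     a \<in> L2 gas_measure \<and>
     (\<forall>\<phi>\<in>H1 gas_measure. - L2_inner gas_measure a \<phi> = dirichlet_form \<alpha> f \<phi>)"

definition generator_domain ::
    "real \<Rightarrow> (complex ^ 'n::{finite,linorder} \<Rightarrow> complex) set" where
  "generator_domain \<alpha> = {f \<in> H1 gas_measure. \<exists>a. is_generator_value \<alpha> f a}"

text \<open>Since \<open>H\<^sup>1\<close> is dense in \<open>L\<^sup>2\<close>, the value is unique up to almost everywhere equality.\<close>

definition generator ::
    "real \<Rightarrow> (complex ^ 'n::{finite,linorder} \<Rightarrow> complex) \<Rightarrow> (complex ^ 'n::{finite,linorder} \<Rightarrow> complex)" where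
  "generator \<alpha> f = (SOME a. is_generator_value \<alpha> f a)"

end

theory Submission
  imports Defs "HOL-Probability.Sinc_Integral"
begin

text \<open>Formally the operator is
\<open>L f = (\<alpha> / n\<^sup>2) (\<Delta> f + \<nabla> (log w) \<bullet> \<nabla> f)\<close>, where \<open>w\<close> is the weight of the gas. The eigenfunctions are
the powers \<open>f = S\<^sup>k\<close> of the center of mass \<open>S z = \<Sum>j. z\<^sub>j\<close>. Such an \<open>f\<close> is holomorphic, so
\<open>\<Delta> f = 0\<close>. Its gradient points along the complex diagonal of \<open>\<complex>\<^sup>n\<close>, in which direction the interaction
\<open>\<Prod>\<bar>z\<^sub>j - z\<^sub>k\<bar>\<^sup>2\<close> is constant; only the Gaussian confinement acts, with drift \<open>-2 n z\<close>, and Euler's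
identity for homogeneous functions gives \<open>L f = - (\<alpha> / n\<^sup>2) 2 n k f\<close>.

Here this computation is carried out in weak form: for every \<open>g\<close> in the form domain, the form of
\<open>g\<close> and \<open>f\<close> is \<open>2 (\<alpha> / n) k\<close> times the inner product of \<open>g\<close> and \<open>f\<close>
(\<open>dirichlet_form_center_power\<close>). Put \<open>\<zeta> = - 2 (\<alpha> / n) k\<close>. If some \<open>g\<close> in the domain solved
\<open>\<zeta> g - L g = f\<close>, the inner product of this equation with \<open>f\<close> would give \<open>\<langle>f, f\<rangle> = 0\<close>. So
\<open>\<zeta> - L\<close> is not surjective, and \<open>\<zeta>\<close> lies in the spectrum.

The weak identity rests on three facts. The derivation \<open>\<partial> = 2 \<Sum>j. \<partial>/\<partial>z\<^sub>j\<close> kills all differences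
\<open>z\<^sub>j - z\<^sub>k\<close>, all conjugates and hence the interaction, and \<open>\<partial> w = - 2 n (cnj S) w\<close>; since
integrals of derivatives of test functions vanish, integration by parts yields the identity for test
functions \<open>g\<close> (\<open>integration_by_parts_wirtinger\<close>). Secondly, \<open>f\<close> does belong to \<open>H\<^sup>1\<close>, with its classical
gradient, by smooth cutoffs (\<open>has_H1_gradient_poly_growth\<close>). Thirdly, the gradient chosen in the
definition of the form agrees almost everywhere with the classical one, because the gradient is
closable (\<open>H1_gradient_unique\<close>). The weight vanishes on the diagonals, so this is not the usual
uniqueness of weak derivatives: test functions are multiplied by \<open>w\<close>, which makes
both sides of the integration by parts square integrable, and the fundamental lemma of the calculus of
variations then determines \<open>G w\<^sup>2\<close>.\<close>

section \<open>Smooth functions and their gradients\<close>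

definition smooth :: "('a::euclidean_space \<Rightarrow> complex) \<Rightarrow> bool" where
  "smooth f \<longleftrightarrow> (\<forall>k. k_times_differentiable k f)"

lemma grad_eqI: "(f has_derivative f') (at x) \<Longrightarrow> grad f b x = f' b"
  unfolding grad_def by (metis frechet_derivative_at)

lemma has_derivative_frechet:
  "f differentiable (at x) \<Longrightarrow> (f has_derivative frechet_derivative f (at x)) (at x)"
  by (simp add: frechet_derivative_works)

lemma grad_add:
  assumes "\<And>x. f differentiable (at x)" "\<And>x. g differentiable (at x)"
  shows "grad (\<lambda>x. f x + g x) b = (\<lambda>x. grad f b x + grad g b x)"
proof
  fix x
  show "grad (\<lambda>x. f x + g x) b x = grad f b x + grad g b x"
    unfolding grad_def[of f] grad_def[of g]
    by (rule grad_eqI[OF has_derivative_add]; rule has_derivative_frechet; rule assms)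
qed

lemma grad_mult:
  assumes "\<And>x. f differentiable (at x)" "\<And>x. g differentiable (at x)"
  shows "grad (\<lambda>x. f x * g x) b = (\<lambda>x. f x * grad g b x + grad f b x * g x)"
proof
  fix x
  show "grad (\<lambda>x. f x * g x) b x = f x * grad g b x + grad f b x * g x"
    unfolding grad_def[of f] grad_def[of g]
    by (rule grad_eqI[OF has_derivative_mult]; rule has_derivative_frechet; rule assms)
qed

lemma grad_linear: "bounded_linear f \<Longrightarrow> grad f b = (\<lambda>x. f b)"
  by (rule ext) (rule grad_eqI, rule bounded_linear_imp_has_derivative)

lemma grad_const: "grad (\<lambda>x. c) b = (\<lambda>x. 0)"
  by (rule ext) (rule grad_eqI[of _ "\<lambda>_. 0"], simp)

lemma k_times_differentiable_mono:
  "k_times_differentiable (Suc k) f \<Longrightarrow> k_times_differentiable k f"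
proof (induction k arbitrary: f)
  case 0
  then show ?case
    by (auto simp: continuous_on_eq_continuous_at intro: differentiable_imp_continuous_within)
next
  case (Suc k)
  then show ?case by (metis k_times_differentiable.simps(2))
qed

lemma smooth_differentiable: "smooth f \<Longrightarrow> f differentiable (at x)"
  unfolding smooth_def by (metis k_times_differentiable.simps(2))

lemma smooth_continuous: "smooth f \<Longrightarrow> continuous_on UNIV f"
  unfolding smooth_def by (metis k_times_differentiable.simps(1))

lemma smooth_grad: "smooth f \<Longrightarrow> b \<in> Basis \<Longrightarrow> smooth (grad f b)"
  unfolding smooth_def by (metis k_times_differentiable.simps(2))

lemma k_times_differentiable_add:
  "k_times_differentiable k f \<Longrightarrow> k_times_differentiable k g \<Longrightarrow>
    k_times_differentiable k (\<lambda>x. f x + g x)"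
proof (induction k arbitrary: f g)
  case 0
  then show ?case by (simp add: continuous_on_add)
next
  case (Suc k)
  then show ?case by (simp add: grad_add differentiable_add)
qed

lemma k_times_differentiable_mult:
  "k_times_differentiable k f \<Longrightarrow> k_times_differentiable k g \<Longrightarrow>
    k_times_differentiable k (\<lambda>x. f x * g x)"
proof (induction k arbitrary: f g)
  case 0
  then show ?case by (simp add: continuous_on_mult)
next
  case (Suc k)
  have fg: "k_times_differentiable k f" "k_times_differentiable k g"
    using Suc.prems by (blast intro: k_times_differentiable_mono)+
  have "k_times_differentiable k (\<lambda>x. f x * grad g b x + grad f b x * g x)" if "b \<in> Basis" for b
    using that Suc.prems fg by (intro k_times_differentiable_add Suc.IH) auto
  then show ?case using Suc.prems by (simp add: grad_mult differentiable_mult)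
qed

lemma smooth_add: "smooth f \<Longrightarrow> smooth g \<Longrightarrow> smooth (\<lambda>x. f x + g x)"
  by (simp add: smooth_def k_times_differentiable_add)

lemma smooth_mult: "smooth f \<Longrightarrow> smooth g \<Longrightarrow> smooth (\<lambda>x. f x * g x)"
  by (simp add: smooth_def k_times_differentiable_mult)

lemma k_times_differentiable_const: "k_times_differentiable k (\<lambda>x. c)"
  by (induction k arbitrary: c) (auto simp: grad_const)

lemma smooth_const: "smooth (\<lambda>x. c)"
  by (simp add: smooth_def k_times_differentiable_const)

lemma smooth_linear:
  assumes "bounded_linear f" shows "smooth f"
proof -
  have "k_times_differentiable k f" for k
    using assms
    by (cases k) (auto simp: grad_linear k_times_differentiable_const linear_continuous_on
        intro: bounded_linear_imp_differentiable)
  then show ?thesis by (simp add: smooth_def)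
qed

lemma smooth_sum: "(\<And>i. i \<in> I \<Longrightarrow> smooth (f i)) \<Longrightarrow> smooth (\<lambda>x. \<Sum>i\<in>I. f i x)"
  by (induction I rule: infinite_finite_induct) (auto intro: smooth_add smooth_const)

lemma smooth_prod: "(\<And>i. i \<in> I \<Longrightarrow> smooth (f i)) \<Longrightarrow> smooth (\<lambda>x. \<Prod>i\<in>I. f i x)"
  by (induction I rule: infinite_finite_induct) (auto intro: smooth_mult smooth_const)

lemma smooth_power: "smooth f \<Longrightarrow> smooth (\<lambda>x. f x ^ k)"
  by (induction k) (auto intro: smooth_mult smooth_const)

lemma smooth_diff: "smooth f \<Longrightarrow> smooth g \<Longrightarrow> smooth (\<lambda>x. f x - g x)"
  using smooth_add[of f "\<lambda>x. (-1) * g x"] smooth_mult[OF smooth_const, of g "-1"] by simp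

lemma smooth_of_real_differentiable:
  assumes "smooth (\<lambda>x. complex_of_real (p x))"
  shows "p differentiable (at x)"
proof -
  have "(\<lambda>x. Re (complex_of_real (p x))) differentiable (at x)"
    using smooth_differentiable[OF assms, of x] bounded_linear.has_derivative[OF bounded_linear_Re]
    unfolding differentiable_def by blast
  then show ?thesis by simp
qed

lemma grad_compose:
  assumes "smooth (\<lambda>x. complex_of_real (p x))"
    and H: "\<And>t. (h has_vector_derivative h' t) (at t)"
  shows "grad (\<lambda>x. h (p x)) b = (\<lambda>x. h' (p x) * grad (\<lambda>x. complex_of_real (p x)) b x)"
    and "(\<lambda>x. h (p x)) differentiable (at x)"
proof -
  have p: "(p has_derivative frechet_derivative p (at x)) (at x)" for x
    by (rule has_derivative_frechet[OF smooth_of_real_differentiable[OF assms(1)]])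
  have h: "(h has_derivative (\<lambda>s. s *\<^sub>R h' t)) (at t)" for t
    using H[of t] by (simp add: has_vector_derivative_def)
  have comp: "((\<lambda>x. h (p x)) has_derivative (\<lambda>v. frechet_derivative p (at x) v *\<^sub>R h' (p x))) (at x)" for x
    using has_derivative_compose[OF p h] by simp
  have q: "grad (\<lambda>x. complex_of_real (p x)) b x = complex_of_real (frechet_derivative p (at x) b)" for x
    by (rule grad_eqI[OF has_derivative_of_real[OF p]])
  show "grad (\<lambda>x. h (p x)) b = (\<lambda>x. h' (p x) * grad (\<lambda>x. complex_of_real (p x)) b x)"
    by (rule ext) (simp add: grad_eqI[OF comp] q scaleR_conv_of_real mult.commute)
  show "(\<lambda>x. h (p x)) differentiable (at x)"
    using comp by (auto simp: differentiable_def)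
qed

text \<open>The induction on the order of differentiability needs all derivatives of the outer function at once,
hence a sequence \<open>h\<close> in which each entry is the derivative of the previous one.\<close>

lemma smooth_compose:
  assumes p: "smooth (\<lambda>x. complex_of_real (p x))"
    and h: "\<And>m t. (h m has_vector_derivative h (Suc m) t) (at t)"
  shows "smooth (\<lambda>x. h m (p x))"
proof -
  have "k_times_differentiable k (\<lambda>x. h m (p x))" for k m
  proof (induction k arbitrary: m)
    case 0
    have "(\<lambda>x. h m (p x)) differentiable (at x)" for x
      by (rule grad_compose[OF p h])
    then show ?case
      by (simp add: continuous_at_imp_continuous_on differentiable_imp_continuous_within)
  next
    case (Suc k)
    have "(\<lambda>x. h m (p x)) differentiable (at x)" for x
      by (rule grad_compose[OF p h])
    moreover have "k_times_differentiable k (grad (\<lambda>x. h m (p x)) b)" if "b \<in> Basis" for b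
      unfolding grad_compose(1)[OF p h]
      using that smooth_grad[OF p that] Suc.IH
      by (intro k_times_differentiable_mult) (auto simp: smooth_def)
    ultimately show ?case by simp
  qed
  then show ?thesis by (simp add: smooth_def)
qed

lemma smooth_exp:
  assumes "smooth (\<lambda>x. complex_of_real (p x))"
  shows "smooth (\<lambda>x. complex_of_real (exp (p x)))"
    and "grad (\<lambda>x. complex_of_real (exp (p x))) b =
      (\<lambda>x. complex_of_real (exp (p x)) * grad (\<lambda>x. complex_of_real (p x)) b x)"
proof -
  have h: "((\<lambda>t. complex_of_real (exp t)) has_vector_derivative complex_of_real (exp t)) (at t)" for t
    by (rule has_vector_derivative_of_real) (rule DERIV_exp)
  show "smooth (\<lambda>x. complex_of_real (exp (p x)))"
    using smooth_compose[OF assms, of "\<lambda>_ t. complex_of_real (exp t)"] h by simp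
  show "grad (\<lambda>x. complex_of_real (exp (p x))) b =
      (\<lambda>x. complex_of_real (exp (p x)) * grad (\<lambda>x. complex_of_real (p x)) b x)"
    by (rule grad_compose(1)[OF assms h])
qed

section \<open>A smooth function that is flat at the origin\<close>

text \<open>For \<open>p = 1\<close> this is the standard smooth function \<open>exp (- 1 / x)\<close>, extended by zero. The factor
\<open>p (1 / x)\<close> makes the family closed under differentiation.\<close>

definition flat :: "real poly \<Rightarrow> real \<Rightarrow> real" where
  "flat p x = (if x > 0 then poly p (1 / x) * exp (- (1 / x)) else 0)"

text \<open>With \<open>y = 1 / x\<close>, the derivative of \<open>p(y) exp (- y)\<close> with respect to \<open>x\<close> is
\<open>y\<^sup>2 (p(y) - p'(y)) exp (- y)\<close>.\<close>

definition flat_deriv :: "real poly \<Rightarrow> real poly" where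
  "flat_deriv p = [:0, 0, 1:] * (p - pderiv p)"

lemma poly_times_exp_tendsto_0: "((\<lambda>y. poly p y * exp (- y)) \<longlongrightarrow> (0::real)) at_top"
proof -
  have "((\<lambda>y. \<Sum>i\<le>degree p. coeff p i * (y ^ i / exp y)) \<longlongrightarrow> (\<Sum>i\<le>degree p. coeff p i * 0)) at_top"
    by (intro tendsto_intros tendsto_power_div_exp_0)
  then show ?thesis
    by (simp add: poly_altdef sum_distrib_right exp_minus divide_inverse mult.assoc)
qed

lemma flat_over_x_tendsto_0: "((\<lambda>x. flat p x / x) \<longlongrightarrow> 0) (at 0)"
proof -
  have "((\<lambda>x. poly (pCons 0 p) (inverse x) * exp (- inverse x)) \<longlongrightarrow> 0) (at_right 0)"
    by (rule filterlim_compose[OF poly_times_exp_tendsto_0 filterlim_inverse_at_top_right])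
  then have right: "((\<lambda>x. flat p x / x) \<longlongrightarrow> 0) (at_right 0)"
    by (rule Lim_transform_eventually)
       (auto simp: eventually_at_right_less flat_def divide_inverse mult.commute
             intro!: eventually_mono[OF eventually_at_right_less])
  have left: "((\<lambda>x. flat p x / x) \<longlongrightarrow> 0) (at_left 0)"
    by (rule tendsto_eventually)
       (auto simp: flat_def eventually_at_left_field intro!: exI[of _ "-1"])
  show ?thesis using left right by (rule filterlim_split_at)
qed

text \<open>Only the origin is delicate. There the difference quotient is \<open>y p(y) exp (- y)\<close> with
\<open>y = 1 / x\<close> tending to infinity.\<close>

lemma flat_has_derivative: "(flat p has_real_derivative flat (flat_deriv p) t) (at t)"
proof -
  consider "t < 0" | "t = 0" | "t > 0" by linarith
  then show ?thesis
  proof cases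
    case 1
    have "((\<lambda>_. 0) has_real_derivative 0) (at t)" by simp
    then have "(flat p has_real_derivative 0) (at t)"
      by (rule has_field_derivative_transform_within_open[of _ _ _ "{..<0}"])
         (use 1 in \<open>auto simp: flat_def\<close>)
    then show ?thesis using 1 by (simp add: flat_def)
  next
    case 2
    have "(flat p has_real_derivative 0) (at 0)"
      using flat_over_x_tendsto_0[of p] by (simp add: DERIV_def flat_def)
    then show ?thesis using 2 by (simp add: flat_def)
  next
    case 3
    have "((\<lambda>x. poly p (1 / x) * exp (- (1 / x))) has_real_derivative
        poly p (1/t) * (exp (- (1/t)) * (1 / t^2)) + poly (pderiv p) (1/t) * (- 1 / t^2) * exp (- (1/t))) (at t)"
      by (rule derivative_eq_intros poly_DERIV DERIV_chain2[OF poly_DERIV] refl | use 3 in \<open>simp add: power2_eq_square\<close>)+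
    moreover have "poly p (1/t) * (exp (- (1/t)) * (1 / t^2)) + poly (pderiv p) (1/t) * (- 1 / t^2) * exp (- (1/t))
      = flat (flat_deriv p) t"
      using 3 by (simp add: flat_def flat_deriv_def field_simps power2_eq_square)
    ultimately have "((\<lambda>x. poly p (1 / x) * exp (- (1 / x))) has_real_derivative flat (flat_deriv p) t) (at t)"
      by simp
    then show ?thesis
      by (rule has_field_derivative_transform_within_open[of _ _ _ "{0<..}"])
         (use 3 in \<open>auto simp: flat_def\<close>)
  qed
qed

lemma flat_continuous: "continuous_on S (flat p)"
  by (rule continuous_at_imp_continuous_on) (meson flat_has_derivative DERIV_isCont)

lemma smooth_flat:
  assumes "smooth (\<lambda>x. complex_of_real (p x))"
  shows "smooth (\<lambda>x. complex_of_real (flat q (p x)))"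
    and "grad (\<lambda>x. complex_of_real (flat q (p x))) b =
      (\<lambda>x. complex_of_real (flat (flat_deriv q) (p x)) * grad (\<lambda>x. complex_of_real (p x)) b x)"
proof -
  have h: "((\<lambda>t. complex_of_real (flat q t)) has_vector_derivative complex_of_real (flat (flat_deriv q) t)) (at t)" for q t
    by (rule has_vector_derivative_of_real) (rule flat_has_derivative)
  show "smooth (\<lambda>x. complex_of_real (flat q (p x)))"
    using smooth_compose[OF assms, of "\<lambda>m t. complex_of_real (flat ((flat_deriv ^^ m) q) t)" 0] h by simp
  show "grad (\<lambda>x. complex_of_real (flat q (p x))) b =
      (\<lambda>x. complex_of_real (flat (flat_deriv q) (p x)) * grad (\<lambda>x. complex_of_real (p x)) b x)"
    by (rule grad_compose(1)[OF assms h])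
qed

section \<open>Test functions and integration by parts\<close>

lemma test_functions_iff:
  fixes f :: "'a::euclidean_space \<Rightarrow> complex"
  shows "f \<in> test_functions \<longleftrightarrow> smooth f \<and> (\<exists>R. \<forall>x. R < norm x \<longrightarrow> f x = 0)"
proof -
  have "compact (closure {x. f x \<noteq> 0}) \<longleftrightarrow> bounded {x. f x \<noteq> 0}"
    by (meson bounded_closure bounded_subset closure_subset compact_closure)
  also have "\<dots> \<longleftrightarrow> (\<exists>R. \<forall>x. R < norm x \<longrightarrow> f x = 0)"
    unfolding bounded_iff by (auto simp: not_less[symmetric])
  finally show ?thesis by (auto simp: test_functions_def smooth_def)
qed

lemma test_functions_smooth: "f \<in> test_functions \<Longrightarrow> smooth f"
  by (simp add: test_functions_iff)

lemma test_functions_mult: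
  "f \<in> test_functions \<Longrightarrow> smooth g \<Longrightarrow> (\<lambda>x. f x * g x) \<in> test_functions"
  by (auto simp: test_functions_iff intro: smooth_mult)

lemma test_functions_diff:
  assumes "f \<in> test_functions" "g \<in> test_functions"
  shows "(\<lambda>x. f x - g x) \<in> test_functions"
proof -
  from assms obtain R S where "\<And>x. R < norm x \<Longrightarrow> f x = 0" "\<And>x. S < norm x \<Longrightarrow> g x = 0"
    by (auto simp: test_functions_iff)
  then have "\<forall>x. max R S < norm x \<longrightarrow> f x - g x = 0" by auto
  with assms show ?thesis unfolding test_functions_iff by (blast intro: smooth_diff)
qed

lemma test_functions_add:
  assumes "f \<in> test_functions" "g \<in> test_functions"
  shows "(\<lambda>x. f x + g x) \<in> test_functions"
  using test_functions_diff[OF assms(1) test_functions_mult[OF assms(2) smooth_const], of "-1"] by simp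

lemma grad_outside_support:
  assumes "\<And>x. R < norm x \<Longrightarrow> f x = 0" "R < norm x"
  shows "grad f b x = 0"
proof -
  have "((\<lambda>_. 0) has_derivative (\<lambda>_. 0)) (at x)" by simp
  then have "(f has_derivative (\<lambda>_. 0)) (at x)"
  proof (rule has_derivative_transform_within_open[of _ _ _ _ "{x. R < norm x}"])
    show "open {x :: 'a. R < norm x}" by (intro open_Collect_less continuous_intros)
  qed (use assms in auto)
  then show ?thesis using grad_eqI[of f "\<lambda>_. 0" x b] by simp
qed

lemma test_functions_grad:
  assumes "f \<in> test_functions" "b \<in> Basis"
  shows "grad f b \<in> test_functions"
proof -
  from assms obtain R where "\<And>x. R < norm x \<Longrightarrow> f x = 0" "smooth f"
    by (auto simp: test_functions_iff)
  then show ?thesis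
    using grad_outside_support[of R f] smooth_grad[OF _ assms(2)]
    by (auto simp: test_functions_iff)
qed

lemma test_functions_measurable: "f \<in> test_functions \<Longrightarrow> f \<in> borel_measurable borel"
  by (simp add: borel_measurable_continuous_onI smooth_continuous test_functions_iff)

lemma test_functions_integrable:
  assumes "f \<in> test_functions"
  shows "integrable lborel f"
proof -
  obtain R where R: "\<And>x. R < norm x \<Longrightarrow> f x = 0" and "smooth f"
    using assms by (auto simp: test_functions_iff)
  have "integrable lborel (\<lambda>x. indicator (cball 0 R) x *\<^sub>R f x)"
    using smooth_continuous[OF \<open>smooth f\<close>]
    by (intro borel_integrable_compact) (auto intro: continuous_on_subset)
  moreover have "(\<lambda>x. indicator (cball 0 R) x *\<^sub>R f x) = f"
    using R by (auto simp: indicator_def fun_eq_iff)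
  ultimately show ?thesis by simp
qed

lemma test_functions_bounded:
  assumes "f \<in> test_functions"
  shows "\<exists>C>0. \<forall>x. norm (f x) \<le> C"
proof -
  obtain R where R: "\<And>x. R < norm x \<Longrightarrow> f x = 0" and "smooth f"
    using assms by (auto simp: test_functions_iff)
  have "compact (f ` cball 0 R)"
    using smooth_continuous[OF \<open>smooth f\<close>]
    by (intro compact_continuous_image) (auto intro: continuous_on_subset)
  then obtain C where "C > 0" "\<And>x. x \<in> cball 0 R \<Longrightarrow> norm (f x) \<le> C"
    by (auto dest!: compact_imp_bounded simp: bounded_pos)
  moreover have "norm (f x) \<le> C" if "x \<notin> cball 0 R" for x
    using R[of x] that \<open>C > 0\<close> by auto
  ultimately show ?thesis by blast
qed

lemma line_has_vector_derivative:
  assumes "f differentiable (at (x + t *\<^sub>R b))"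
  shows "((\<lambda>s. f (x + s *\<^sub>R b)) has_vector_derivative grad f b (x + t *\<^sub>R b)) (at t)"
proof -
  note D = has_derivative_frechet[OF assms]
  have "((\<lambda>s. x + s *\<^sub>R b) has_derivative (\<lambda>s. s *\<^sub>R b)) (at t)"
    by (auto intro!: derivative_eq_intros)
  from has_derivative_compose[OF this D]
  have "((\<lambda>s. f (x + s *\<^sub>R b)) has_derivative
      (\<lambda>s. frechet_derivative f (at (x + t *\<^sub>R b)) (s *\<^sub>R b))) (at t)" .
  then show ?thesis
    using linear_scale[OF has_derivative_linear[OF D]]
    by (simp add: has_vector_derivative_def grad_def)
qed

text \<open>By translation invariance the integral of every difference quotient is zero. The quotients are bounded by
the supremum of the derivative and supported in a fixed ball, so dominated convergence applies.\<close>

lemma integral_grad_test_function: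
  assumes f: "f \<in> test_functions" and b: "b \<in> Basis"
  shows "(\<integral>x. grad f b x \<partial>lborel) = 0"
proof -
  obtain R where R: "\<And>x. R < norm x \<Longrightarrow> f x = 0" and smooth: "smooth f"
    using f by (auto simp: test_functions_iff)
  obtain C where C: "C > 0" "\<And>x. norm (grad f b x) \<le> C"
    using test_functions_bounded[OF test_functions_grad[OF f b]] by blast
  note [measurable] = test_functions_measurable[OF f]
    test_functions_measurable[OF test_functions_grad[OF f b]]
  have deriv: "((\<lambda>s. f (x + s *\<^sub>R b)) has_vector_derivative grad f b (x + t *\<^sub>R b)) (at t)" for x t
    by (rule line_has_vector_derivative[OF smooth_differentiable[OF smooth]])
  define s where "s n = inverse (real (Suc n))" for n
  have s: "s n > 0" "s n \<le> 1" for n by (auto simp: s_def field_simps)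
  define q where "q n x = (f (x + s n *\<^sub>R b) - f x) /\<^sub>R s n" for n x
  have shift: "integrable lborel (\<lambda>x. f (x + s n *\<^sub>R b))"
    "(\<integral>x. f (x + s n *\<^sub>R b) \<partial>lborel) = (\<integral>x. f x \<partial>lborel)" for n
  proof -
    have "integrable (distr lborel borel ((+) (s n *\<^sub>R b))) f"
      using test_functions_integrable[OF f] by (simp add: lborel_distr_plus)
    then show "integrable lborel (\<lambda>x. f (x + s n *\<^sub>R b))"
      using integrable_distr[of "(+) (s n *\<^sub>R b)" lborel borel f] by (simp add: add.commute)
    show "(\<integral>x. f (x + s n *\<^sub>R b) \<partial>lborel) = (\<integral>x. f x \<partial>lborel)"
      using integral_distr[of "(+) (s n *\<^sub>R b)" lborel borel f]
      by (simp add: lborel_distr_plus add.commute)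
  qed
  have "(\<integral>x. q n x \<partial>lborel) = 0" for n
    unfolding q_def using shift[of n] test_functions_integrable[OF f] by simp
  moreover have "(\<lambda>n. \<integral>x. q n x \<partial>lborel) \<longlonglongrightarrow> (\<integral>x. grad f b x \<partial>lborel)"
  proof (rule integral_dominated_convergence)
    show "integrable lborel (\<lambda>x::'a. indicator (cball 0 (R + 1)) x *\<^sub>R C)"
      by (intro borel_integrable_compact) auto
    show "AE x in lborel. (\<lambda>n. q n x) \<longlonglongrightarrow> grad f b x"
    proof (rule AE_I2)
      fix x
      have lim: "filterlim s (at 0) sequentially"
        unfolding filterlim_at using s(1) LIMSEQ_inverse_real_of_nat
        by (auto simp: s_def[abs_def] intro!: always_eventually)
      have "((\<lambda>t. f (x + t *\<^sub>R b)) has_vector_derivative grad f b x) (at 0)"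
        using deriv[of x 0] by simp
      then have lim0: "((\<lambda>h. norm (f (x + h *\<^sub>R b) - f x - h *\<^sub>R grad f b x) / norm h) \<longlongrightarrow> 0) (at 0)"
        by (simp add: has_vector_derivative_def has_derivative_at)
      have "\<forall>\<^sub>F h in at 0. norm ((f (x + h *\<^sub>R b) - f x) /\<^sub>R h - grad f b x)
          \<le> norm (f (x + h *\<^sub>R b) - f x - h *\<^sub>R grad f b x) / norm h"
      proof (rule eventually_mono[OF eventually_neq_at_within[of 0]])
        fix h :: real assume "h \<noteq> 0"
        then have "(f (x + h *\<^sub>R b) - f x) /\<^sub>R h - grad f b x =
            (f (x + h *\<^sub>R b) - f x - h *\<^sub>R grad f b x) /\<^sub>R h"
          by (simp add: scaleR_right_diff_distrib)
        then show "norm ((f (x + h *\<^sub>R b) - f x) /\<^sub>R h - grad f b x)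
            \<le> norm (f (x + h *\<^sub>R b) - f x - h *\<^sub>R grad f b x) / norm h"
          by (simp add: divide_inverse mult.commute)
      qed
      then have "((\<lambda>h. (f (x + h *\<^sub>R b) - f x) /\<^sub>R h) \<longlongrightarrow> grad f b x) (at 0)"
        by (rule LIM_zero_cancel[OF Lim_null_comparison[OF _ lim0]])
      from filterlim_compose[OF this lim] show "(\<lambda>n. q n x) \<longlonglongrightarrow> grad f b x"
        by (simp add: q_def)
    qed
    show "AE x in lborel. norm (q n x) \<le> indicator (cball 0 (R + 1)) x *\<^sub>R C" for n
    proof (rule AE_I2)
      fix x
      have "norm (f (x + s n *\<^sub>R b) - f (x + 0 *\<^sub>R b)) \<le> C * norm (s n - 0)"
      proof (rule differentiable_bound[of UNIV])
        show "((\<lambda>t. f (x + t *\<^sub>R b)) has_derivative (\<lambda>h. h *\<^sub>R grad f b (x + t *\<^sub>R b))) (at t within UNIV)" for t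
          using deriv[of x t] by (simp add: has_vector_derivative_def)
        show "onorm (\<lambda>h. h *\<^sub>R grad f b (x + t *\<^sub>R b)) \<le> C" for t
          using C by (intro onorm_le) (simp add: mult.commute[of C] mult_left_mono)
      qed auto
      then have "norm (q n x) \<le> C"
        using s[of n] by (simp add: q_def inverse_eq_divide pos_divide_le_eq)
      moreover have "q n x = 0" if "x \<notin> cball 0 (R + 1)"
      proof -
        have "norm x \<le> norm (x + s n *\<^sub>R b) + norm (s n *\<^sub>R b)"
          using norm_triangle_ineq4[of "x + s n *\<^sub>R b" "s n *\<^sub>R b"] by simp
        then have "R < norm (x + s n *\<^sub>R b)" "R < norm x"
          using that s[of n] b by auto
        then show ?thesis by (simp add: q_def R)
      qed
      ultimately show "norm (q n x) \<le> indicator (cball 0 (R + 1)) x *\<^sub>R C"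
        by (auto simp: indicator_def)
    qed
  qed (auto simp: q_def)
  ultimately show ?thesis by (simp add: LIMSEQ_const_iff)
qed

lemma integration_by_parts:
  assumes u: "u \<in> test_functions" and v: "smooth v" and b: "b \<in> Basis"
  shows "(\<integral>x. grad u b x * v x \<partial>lborel) = - (\<integral>x. u x * grad v b x \<partial>lborel)"
proof -
  note u' = test_functions_smooth[OF u]
  have "(\<integral>x. u x * grad v b x + grad u b x * v x \<partial>lborel) = 0"
    using integral_grad_test_function[OF test_functions_mult[OF u v] b]
    by (simp add: grad_mult[OF smooth_differentiable[OF u'] smooth_differentiable[OF v]])
  moreover have "integrable lborel (\<lambda>x. u x * grad v b x)" "integrable lborel (\<lambda>x. grad u b x * v x)"
    using test_functions_grad[OF u b] smooth_grad[OF v b] u v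
    by (auto intro!: test_functions_integrable test_functions_mult)
  ultimately show ?thesis by (simp add: add_eq_0_iff2)
qed

section \<open>The fundamental lemma of the calculus of variations\<close>

lemma smooth_coordinate: "smooth (\<lambda>x::'a::euclidean_space. complex_of_real (x \<bullet> b))"
  by (intro smooth_linear bounded_linear_of_real[THEN bounded_linear_compose] bounded_linear_inner_left)

lemma flat_one: "0 \<le> flat 1 x" "flat 1 x \<le> 1" "x \<le> 0 \<Longrightarrow> flat 1 x = 0"
  by (auto simp: flat_def)

lemma flat_one_tendsto:
  assumes "x > 0" shows "(\<lambda>n. flat 1 (real n * x)) \<longlonglongrightarrow> 1"
proof -
  have "(\<lambda>n. exp (- (inverse x * inverse (real n)))) \<longlonglongrightarrow> exp (- (inverse x * 0))"
    by (intro tendsto_intros LIMSEQ_inverse_real_of_nat lim_inverse_n)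
  moreover have "\<forall>\<^sub>F n in sequentially. exp (- (inverse x * inverse (real n))) = flat 1 (real n * x)"
    using eventually_gt_at_top[of 0] by eventually_elim (use assms in \<open>auto simp: flat_def field_simps\<close>)
  ultimately show ?thesis by (auto intro: Lim_transform_eventually)
qed

text \<open>The first factor switches on at the lower face of the box in direction \<open>b\<close>, the second switches off at the
upper face; as \<open>n\<close> grows, both approach one inside the box, since \<open>exp (- 1 / (n s)) \<longlonglongrightarrow> 1\<close>.\<close>

definition box_bump :: "'a::euclidean_space \<Rightarrow> 'a \<Rightarrow> nat \<Rightarrow> 'a \<Rightarrow> real" where
  "box_bump l u n x =
    (\<Prod>b\<in>Basis. flat 1 (real n * (x \<bullet> b - l \<bullet> b)) * flat 1 (real n * (u \<bullet> b - x \<bullet> b)))"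

lemma box_bump_bounds: "0 \<le> box_bump l u n x" "box_bump l u n x \<le> 1"
  unfolding box_bump_def
  by (intro prod_nonneg prod_le_1 ballI mult_nonneg_nonneg conjI mult_le_one flat_one)+

lemma box_bump_eq_0:
  assumes "x \<notin> box l u" shows "box_bump l u n x = 0"
proof -
  obtain b where b: "b \<in> Basis" "x \<bullet> b \<le> l \<bullet> b \<or> u \<bullet> b \<le> x \<bullet> b"
    using assms by (force simp: mem_box)
  then have "flat 1 (real n * (x \<bullet> b - l \<bullet> b)) * flat 1 (real n * (u \<bullet> b - x \<bullet> b)) = 0"
    by (auto simp: flat_one(3) mult_nonneg_nonpos)
  with b show ?thesis unfolding box_bump_def by (intro prod_zero) auto
qed

lemma box_bump_tendsto: "(\<lambda>n. box_bump l u n x) \<longlonglongrightarrow> indicator (box l u) x"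
proof (cases "x \<in> box l u")
  case True
  have "(\<lambda>n. box_bump l u n x) \<longlonglongrightarrow> (\<Prod>b\<in>(Basis::'a set). 1 * 1)"
    unfolding box_bump_def
    by (intro tendsto_prod tendsto_mult flat_one_tendsto) (use True in \<open>auto simp: mem_box\<close>)
  then show ?thesis using True by simp
qed (simp add: box_bump_eq_0)

lemma box_bump_test_function: "(\<lambda>x. complex_of_real (box_bump l u n x)) \<in> test_functions"
proof -
  have "smooth (\<lambda>x. complex_of_real (real n * (x \<bullet> b - l \<bullet> b)))"
    "smooth (\<lambda>x. complex_of_real (real n * (u \<bullet> b - x \<bullet> b)))" for b :: 'a
    by (simp_all only: of_real_mult of_real_diff)
       (intro smooth_mult smooth_diff smooth_const smooth_coordinate)+
  then have "smooth (\<lambda>x. complex_of_real (box_bump l u n x))"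
    unfolding box_bump_def of_real_prod of_real_mult[of "flat _ _"]
    by (intro smooth_prod smooth_mult smooth_flat) 
  moreover obtain R where R: "\<And>x. x \<in> box l u \<Longrightarrow> norm x \<le> R"
    using bounded_box[of l u] by (auto simp: bounded_iff)
  then have "\<forall>x. R < norm x \<longrightarrow> complex_of_real (box_bump l u n x) = 0"
    by (metis box_bump_eq_0 not_less of_real_0)
  ultimately show ?thesis by (auto simp: test_functions_iff)
qed

lemma AE_nonpos_if_set_integrals_zero:
  fixes g :: "'a \<Rightarrow> real"
  assumes int: "integrable M g" and zero: "\<And>A. A \<in> sets M \<Longrightarrow> (\<integral>x. indicator A x * g x \<partial>M) = 0"
  shows "AE x in M. g x \<le> 0"
proof -
  note [measurable] = borel_measurable_integrable[OF int]
  let ?A = "{x \<in> space M. 0 < g x}"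
  have A: "?A \<in> sets M" by measurable
  have "integrable M (\<lambda>x. indicator ?A x * g x)"
    using integrable_mult_indicator[OF A int] by simp
  then have "AE x in M. indicator ?A x * g x = 0"
    using zero[OF A] by (subst integral_nonneg_eq_0_iff_AE[symmetric]) (auto simp: indicator_def)
  then show ?thesis by (rule AE_mp) (auto simp: indicator_def not_less)
qed

lemma AE_zero_if_set_integrals_zero:
  fixes h :: "'a \<Rightarrow> complex"
  assumes int: "integrable M h" and zero: "\<And>A. A \<in> sets M \<Longrightarrow> (\<integral>x. indicator A x *\<^sub>R h x \<partial>M) = 0"
  shows "AE x in M. h x = 0"
proof -
  have int': "integrable M (\<lambda>x. indicator A x *\<^sub>R h x)" if "A \<in> sets M" for A
    using integrable_mult_indicator[OF that int] .
  have re: "(\<integral>x. indicator A x * Re (h x) \<partial>M) = 0" and im: "(\<integral>x. indicator A x * Im (h x) \<partial>M) = 0"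
    if "A \<in> sets M" for A
    using integral_bounded_linear[OF bounded_linear_Re int'[OF that]]
      integral_bounded_linear[OF bounded_linear_Im int'[OF that]] zero[OF that] by simp_all
  have "AE x in M. Re (h x) \<le> 0" "AE x in M. - Re (h x) \<le> 0"
    "AE x in M. Im (h x) \<le> 0" "AE x in M. - Im (h x) \<le> 0"
    by (rule AE_nonpos_if_set_integrals_zero; use int re im in simp)+
  then show ?thesis by eventually_elim (auto simp: complex_eq_iff)
qed

text \<open>Indicators of boxes are bounded pointwise limits of test functions, so the integral of \<open>h\<close> over every
box is zero. Boxes are stable under intersection and generate the Borel sets, so the same holds for
all Borel sets.\<close>

lemma fundamental_lemma_calculus_of_variations:
  fixes h :: "'a::euclidean_space \<Rightarrow> complex"
  assumes int: "integrable lborel h"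
    and zero: "\<And>\<psi>. \<psi> \<in> test_functions \<Longrightarrow> (\<integral>x. \<psi> x * h x \<partial>lborel) = 0"
  shows "AE x in lborel. h x = 0"
proof (rule AE_zero_if_set_integrals_zero[OF int])
  note [measurable] = borel_measurable_integrable[OF int]
  note int' = integrable_mult_indicator[OF _ int]
  have box: "(\<integral>x. indicator (box l u) x *\<^sub>R h x \<partial>lborel) = 0" for l u :: 'a
  proof -
    have "(\<lambda>n. \<integral>x. box_bump l u n x *\<^sub>R h x \<partial>lborel) \<longlonglongrightarrow> (\<integral>x. indicator (box l u) x *\<^sub>R h x \<partial>lborel)"
    proof (rule integral_dominated_convergence)
      show "integrable lborel (\<lambda>x. norm (h x))" using int by simp
      show "AE x in lborel. (\<lambda>n. box_bump l u n x *\<^sub>R h x) \<longlonglongrightarrow> indicator (box l u) x *\<^sub>R h x"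
        by (intro AE_I2 tendsto_intros box_bump_tendsto)
      show "AE x in lborel. norm (box_bump l u n x *\<^sub>R h x) \<le> norm (h x)" for n
        using box_bump_bounds[of l u n] by (auto intro!: AE_I2 mult_left_le_one_le)
      show "(\<lambda>x. box_bump l u n x *\<^sub>R h x) \<in> borel_measurable lborel" for n
        using test_functions_measurable[OF box_bump_test_function[of l u n]]
        by (simp add: scaleR_conv_of_real)
    qed auto
    moreover have "(\<integral>x. box_bump l u n x *\<^sub>R h x \<partial>lborel) = 0" for n
      using zero[OF box_bump_test_function] by (simp add: scaleR_conv_of_real)
    ultimately show ?thesis by (simp add: LIMSEQ_const_iff)
  qed
  have total: "(\<integral>x. h x \<partial>lborel) = 0"
  proof -
    let ?B = "\<lambda>n::nat. box (- (real n *\<^sub>R One)) (real n *\<^sub>R One) :: 'a set"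
    have "(\<lambda>n. \<integral>x. indicator (?B n) x *\<^sub>R h x \<partial>lborel) \<longlonglongrightarrow> (\<integral>x. h x \<partial>lborel)"
    proof (rule integral_dominated_convergence)
      show "integrable lborel (\<lambda>x. norm (h x))" using int by simp
      show "AE x in lborel. (\<lambda>n. indicator (?B n) x *\<^sub>R h x) \<longlonglongrightarrow> h x"
      proof (rule AE_I2)
        fix x :: 'a
        obtain N where "x \<in> ?B N" using UN_box_eq_UNIV by blast
        then have "x \<in> ?B n" if "n \<ge> N" for n
          using that unfolding mem_box by (force intro: order_less_le_trans order_le_less_trans)
        then show "(\<lambda>n. indicator (?B n) x *\<^sub>R h x) \<longlonglongrightarrow> h x"
          by (intro tendsto_eventually eventually_sequentiallyI[of N]) simp
      qed
    qed (auto simp: indicator_def)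
    then show ?thesis by (simp add: box LIMSEQ_const_iff)
  qed
  have sets: "sigma_sets UNIV (range (\<lambda>(a, b). box a b)) = sets (lborel :: 'a measure)"
    by (simp add: borel_eq_box)
  have "Int_stable (range (\<lambda>(a, b). box a b :: 'a set))"
    by (auto simp: Int_stable_def box_Int_box)
  moreover have "range (\<lambda>(a, b). box a b :: 'a set) \<subseteq> Pow UNIV" by simp
  moreover fix A :: "'a set" assume "A \<in> sets lborel"
  then have "A \<in> sigma_sets UNIV (range (\<lambda>(a, b). box a b))" by (simp add: sets)
  ultimately show "(\<integral>x. indicator A x *\<^sub>R h x \<partial>lborel) = 0"
  proof (induction rule: sigma_sets_induct_disjoint)
    case (compl A)
    then have A: "A \<in> sets lborel" using sets by simp
    have "(\<integral>x. indicator (UNIV - A) x *\<^sub>R h x \<partial>lborel) = (\<integral>x. h x - indicator A x *\<^sub>R h x \<partial>lborel)"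
      by (intro Bochner_Integration.integral_cong) (auto simp: indicator_def)
    also have "\<dots> = 0" using int'[OF A] int total compl by simp
    finally show ?case .
  next
    case (union A)
    then have A: "A i \<in> sets lborel" for i using sets by auto
    have "(\<integral>x. indicator (\<Union>i. A i) x *\<^sub>R h x \<partial>lborel) = (\<Sum>i. \<integral>x. indicator (A i) x *\<^sub>R h x \<partial>lborel)"
      using lebesgue_integral_countable_add[of A lborel h] A union(1) int'[of "\<Union>i. A i"]
      by (auto simp: set_lebesgue_integral_def set_integrable_def disjoint_family_on_def)
    then show ?case using union by simp
  qed (use box in auto)
qed

section \<open>Square-integrable functions\<close>

lemma L2_measurable: "f \<in> L2 M \<Longrightarrow> f \<in> borel_measurable M"
  by (simp add: L2_def)

lemma L2_integrable: "f \<in> L2 M \<Longrightarrow> integrable M (\<lambda>x. (cmod (f x))\<^sup>2)"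
  by (simp add: L2_def)

lemma borel_measurable_cnj: "f \<in> borel_measurable M \<Longrightarrow> (\<lambda>x. cnj (f x)) \<in> borel_measurable M"
  by (rule measurable_compose[OF _ borel_measurable_continuous_onI]) (auto intro: continuous_intros)

lemma L2_cnj: "f \<in> L2 M \<Longrightarrow> (\<lambda>x. cnj (f x)) \<in> L2 M"
  by (simp add: L2_def borel_measurable_cnj)

lemma L2_diff:
  assumes f: "f \<in> L2 M" and g: "g \<in> L2 M" shows "(\<lambda>x. f x - g x) \<in> L2 M"
proof -
  note [measurable] = L2_measurable[OF f] L2_measurable[OF g]
  have "(cmod (f x - g x))\<^sup>2 \<le> 2 * (cmod (f x))\<^sup>2 + 2 * (cmod (g x))\<^sup>2" for x
  proof -
    have "(cmod (f x - g x))\<^sup>2 \<le> (cmod (f x) + cmod (g x))\<^sup>2"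
      by (intro power_mono norm_triangle_ineq4) simp
    also have "\<dots> \<le> 2 * (cmod (f x))\<^sup>2 + 2 * (cmod (g x))\<^sup>2"
      using sum_squares_bound[of "cmod (f x)" "cmod (g x)"] by (simp add: power2_sum)
    finally show ?thesis .
  qed
  then have bound: "AE x in M. norm ((cmod (f x - g x))\<^sup>2) \<le> norm (2 * (cmod (f x))\<^sup>2 + 2 * (cmod (g x))\<^sup>2)"
    by (intro AE_I2) simp
  have "integrable M (\<lambda>x. (cmod (f x - g x))\<^sup>2)"
    by (rule Bochner_Integration.integrable_bound[OF _ _ bound])
       (intro Bochner_Integration.integrable_add integrable_mult_right L2_integrable f g, measurable)
  then show ?thesis by (simp add: L2_def)
qed

lemma L2_mult_integrable:
  assumes f: "f \<in> L2 M" and g: "g \<in> L2 M"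
  shows "integrable M (\<lambda>x. f x * g x)" "integrable M (\<lambda>x. cmod (f x) * cmod (g x))"
proof -
  note [measurable] = L2_measurable[OF f] L2_measurable[OF g]
  have "cmod (f x) * cmod (g x) \<le> (cmod (f x))\<^sup>2 + (cmod (g x))\<^sup>2" for x
    using sum_squares_bound[of "cmod (f x)" "cmod (g x)"]
      mult_nonneg_nonneg[OF norm_ge_zero norm_ge_zero, of "f x" "g x"] by linarith
  then have bound: "AE x in M. norm (f x * g x) \<le> norm ((cmod (f x))\<^sup>2 + (cmod (g x))\<^sup>2)"
    by (intro AE_I2) (simp add: norm_mult)
  show "integrable M (\<lambda>x. f x * g x)"
    by (rule Bochner_Integration.integrable_bound[OF _ _ bound])
       (intro Bochner_Integration.integrable_add L2_integrable f g, measurable)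
  from integrable_norm[OF this] show "integrable M (\<lambda>x. cmod (f x) * cmod (g x))"
    by (simp add: norm_mult)
qed

lemma L2_norm_nonneg: "0 \<le> L2_norm M f"
  by (simp add: L2_norm_def)

lemma L2_norm_power2: "(L2_norm M f)\<^sup>2 = (\<integral>x. (cmod (f x))\<^sup>2 \<partial>M)"
  by (simp add: L2_norm_def)

lemma L2_Cauchy_Schwarz:
  assumes f: "f \<in> L2 M" and g: "g \<in> L2 M"
  shows "cmod (\<integral>x. f x * g x \<partial>M) \<le> L2_norm M f * L2_norm M g"
proof -
  note [measurable] = L2_measurable[OF f] L2_measurable[OF g]
  let ?I = "\<integral>x. cmod (f x) * cmod (g x) \<partial>M"
  have nn: "(\<integral>\<^sup>+x. (ennreal (cmod (f x)))\<^sup>2 \<partial>M) = ennreal ((L2_norm M f)\<^sup>2)" if "f \<in> L2 M" for f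
    using L2_integrable[OF that]
    by (simp add: L2_norm_power2 nn_integral_eq_integral ennreal_power)
  have "(\<integral>\<^sup>+x. ennreal (cmod (f x)) * ennreal (cmod (g x)) \<partial>M) = ennreal ?I"
    using L2_mult_integrable(2)[OF f g] by (simp add: nn_integral_eq_integral ennreal_mult[symmetric])
  then have "ennreal (?I\<^sup>2) \<le> ennreal ((L2_norm M f)\<^sup>2 * (L2_norm M g)\<^sup>2)"
    using Cauchy_Schwarz_nn_integral[of "\<lambda>x. ennreal (cmod (f x))" M "\<lambda>x. ennreal (cmod (g x))"]
    by (simp add: nn[OF f] nn[OF g] ennreal_power[symmetric] ennreal_mult)
  then have "?I\<^sup>2 \<le> (L2_norm M f * L2_norm M g)\<^sup>2"
    by (simp add: power_mult_distrib)
  then have "?I \<le> L2_norm M f * L2_norm M g"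
    by (rule power2_le_imp_le) (simp add: L2_norm_nonneg)
  moreover have "cmod (\<integral>x. f x * g x \<partial>M) \<le> ?I"
    using integral_norm_bound[of M "\<lambda>x. f x * g x"] by (simp add: norm_mult)
  ultimately show ?thesis by linarith
qed

text \<open>This is how identities for test functions pass to their limits in \<open>H\<^sup>1\<close>.\<close>

lemma L2_limit:
  assumes \<phi>: "\<And>i. \<phi> i \<in> L2 M" and f: "f \<in> L2 M" and g: "g \<in> L2 M"
    and lim: "(\<lambda>i. L2_norm M (\<lambda>x. \<phi> i x - f x)) \<longlonglongrightarrow> 0"
  shows "(\<lambda>i. \<integral>x. \<phi> i x * g x \<partial>M) \<longlonglongrightarrow> (\<integral>x. f x * g x \<partial>M)"
proof (rule LIM_zero_cancel, rule Lim_null_comparison)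
  show "(\<lambda>i. L2_norm M (\<lambda>x. \<phi> i x - f x) * L2_norm M g) \<longlonglongrightarrow> 0"
    using tendsto_mult_right[OF lim] by simp
  have "cmod ((\<integral>x. \<phi> i x * g x \<partial>M) - (\<integral>x. f x * g x \<partial>M)) \<le> L2_norm M (\<lambda>x. \<phi> i x - f x) * L2_norm M g" for i
    using L2_Cauchy_Schwarz[OF L2_diff[OF \<phi> f] g, of i] L2_mult_integrable(1)[OF \<phi> g, of i]
      L2_mult_integrable(1)[OF f g] by (simp add: left_diff_distrib)
  then show "\<forall>\<^sub>F i in sequentially. norm ((\<integral>x. \<phi> i x * g x \<partial>M) - (\<integral>x. f x * g x \<partial>M))
      \<le> L2_norm M (\<lambda>x. \<phi> i x - f x) * L2_norm M g" by simp
qed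

section \<open>Gradients of Sobolev functions\<close>

lemma has_H1_gradient_approx:
  assumes "has_H1_gradient M f G"
  obtains \<phi> where "\<And>i::nat. \<phi> i \<in> test_functions"
    "(\<lambda>i. L2_norm M (\<lambda>x. \<phi> i x - f x)) \<longlonglongrightarrow> 0"
    "\<And>b. b \<in> Basis \<Longrightarrow> (\<lambda>i. L2_norm M (\<lambda>x. grad (\<phi> i) b x - G b x)) \<longlonglongrightarrow> 0"
proof -
  obtain \<phi> where \<phi>: "\<And>i::nat. \<phi> i \<in> test_functions"
    and lim: "(\<lambda>i. sqrt ((L2_norm M (\<lambda>x. \<phi> i x - f x))\<^sup>2 +
                  (\<Sum>b\<in>Basis. (L2_norm M (\<lambda>x. grad (\<phi> i) b x - G b x))\<^sup>2))) \<longlonglongrightarrow> 0"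
    using assms by (auto simp: has_H1_gradient_def)
  show thesis
  proof (rule that[OF \<phi>])
    have "L2_norm M (\<lambda>x. \<phi> i x - f x) \<le> sqrt ((L2_norm M (\<lambda>x. \<phi> i x - f x))\<^sup>2 +
                  (\<Sum>b\<in>Basis. (L2_norm M (\<lambda>x. grad (\<phi> i) b x - G b x))\<^sup>2))" for i
      by (rule real_le_rsqrt) (simp add: sum_nonneg)
    then show "(\<lambda>i. L2_norm M (\<lambda>x. \<phi> i x - f x)) \<longlonglongrightarrow> 0"
      by (intro tendsto_sandwich[OF _ _ tendsto_const lim]) (auto simp: L2_norm_nonneg)
    fix b :: 'a assume b: "b \<in> Basis"
    have "L2_norm M (\<lambda>x. grad (\<phi> i) b x - G b x) \<le> sqrt ((L2_norm M (\<lambda>x. \<phi> i x - f x))\<^sup>2 +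
                  (\<Sum>b\<in>Basis. (L2_norm M (\<lambda>x. grad (\<phi> i) b x - G b x))\<^sup>2))" for i
      using member_le_sum[of b Basis "\<lambda>b. (L2_norm M (\<lambda>x. grad (\<phi> i) b x - G b x))\<^sup>2"] b
      by (intro real_le_rsqrt) (simp add: add_increasing)
    then show "(\<lambda>i. L2_norm M (\<lambda>x. grad (\<phi> i) b x - G b x)) \<longlonglongrightarrow> 0"
      by (intro tendsto_sandwich[OF _ _ tendsto_const lim]) (auto simp: L2_norm_nonneg)
  qed
qed

lemma has_H1_gradient_H1_grad: "f \<in> H1 M \<Longrightarrow> has_H1_gradient M f (H1_grad M f)"
  unfolding H1_def H1_grad_def using someI_ex[of "has_H1_gradient M f"] by blast

section \<open>The weight of the gas\<close>

lemma smooth_component: "smooth (\<lambda>z::complex ^ 'n. z $ j)"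
  by (intro smooth_linear bounded_linear_vec_nth)

lemma smooth_cnj_component: "smooth (\<lambda>z::complex ^ 'n. cnj (z $ j))"
  by (intro smooth_linear bounded_linear_compose[OF bounded_linear_cnj] bounded_linear_vec_nth)

text \<open>The exponent of the Gaussian factor of the weight, including its sign.\<close>

definition confinement_exponent :: "complex ^ 'n \<Rightarrow> real" where
  "confinement_exponent z = - real CARD('n) * (\<Sum>k\<in>UNIV. (cmod (z $ k))\<^sup>2)"

lemma of_real_confinement_exponent:
  "complex_of_real (confinement_exponent (z :: complex ^ 'n)) = - of_nat CARD('n) * (\<Sum>k\<in>UNIV. z $ k * cnj (z $ k))"
  by (simp add: confinement_exponent_def complex_norm_square[symmetric] del: of_real_power)

lemma smooth_confinement_exponent: "smooth (\<lambda>z. complex_of_real (confinement_exponent z))"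
  unfolding of_real_confinement_exponent
  by (intro smooth_mult smooth_const smooth_sum smooth_component smooth_cnj_component)

text \<open>The squared modulus of the Vandermonde determinant, written as a polynomial in the coordinates and
their conjugates so that smoothness and derivatives can be read off factor by factor.\<close>

definition vandermonde_sq :: "complex ^ 'n::{finite,linorder} \<Rightarrow> complex" where
  "vandermonde_sq z = (\<Prod>(j, k)\<in>{(j, k). j < k}. (z $ j - z $ k) * (cnj (z $ j) - cnj (z $ k)))"

lemma smooth_vandermonde_sq: "smooth vandermonde_sq"
  unfolding vandermonde_sq_def case_prod_beta
  by (intro smooth_mult smooth_prod smooth_diff smooth_component smooth_cnj_component)

lemma of_real_gas_weight:
  "complex_of_real (gas_weight z) = complex_of_real (exp (confinement_exponent z)) * vandermonde_sq z"
  by (simp add: gas_weight_def confinement_exponent_def vandermonde_sq_def case_prod_beta complex_norm_square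
      complex_cnj_diff[symmetric] del: of_real_power complex_cnj_diff)

abbreviation cweight :: "complex ^ 'n::{finite,linorder} \<Rightarrow> complex" where
  "cweight \<equiv> \<lambda>z. complex_of_real (gas_weight z)"

lemma smooth_gas_weight: "smooth (\<lambda>z. complex_of_real (gas_weight z))"
  unfolding of_real_gas_weight
  by (intro smooth_mult smooth_exp smooth_confinement_exponent smooth_vandermonde_sq)

lemma gas_weight_nonneg: "0 \<le> gas_weight z"
  by (auto simp: gas_weight_def case_prod_beta intro!: mult_nonneg_nonneg prod_nonneg)

lemma gas_weight_continuous: "continuous_on UNIV gas_weight"
  using continuous_on_Re[OF smooth_continuous[OF smooth_gas_weight]] by simp

lemma gas_weight_measurable [measurable]: "gas_weight \<in> borel_measurable borel"
  by (rule borel_measurable_continuous_onI[OF gas_weight_continuous])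

lemma integrable_prod_inverse:
  "integrable lborel (\<lambda>x::'a::euclidean_space. \<Prod>b\<in>Basis. inverse (1 + (x \<bullet> b)\<^sup>2))"
proof (rule integrableI_nonneg)
  have "integrable lborel (\<lambda>t::real. inverse (1 + t\<^sup>2))"
    using integrable_inverse_1_plus_square by (simp add: set_integrable_def einterval_def)
  then have "(\<integral>\<^sup>+t. ennreal (inverse (1 + t\<^sup>2)) \<partial>lborel) < \<infinity>"
    by (subst nn_integral_eq_integral) auto
  moreover have "(\<integral>\<^sup>+x. ennreal (\<Prod>b\<in>Basis. inverse (1 + (x \<bullet> b)\<^sup>2)) \<partial>(lborel :: 'a measure))
      = (\<Prod>b\<in>(Basis::'a set). \<integral>\<^sup>+t. ennreal (inverse (1 + t\<^sup>2)) \<partial>lborel)"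
    by (subst nn_integral_lborel_prod[symmetric]) (auto simp: prod_ennreal)
  ultimately show "(\<integral>\<^sup>+x. ennreal (\<Prod>b\<in>Basis. inverse (1 + (x \<bullet> b)\<^sup>2)) \<partial>(lborel :: 'a measure)) < \<infinity>"
    by (simp add: power_less_top_ennreal)
qed (auto intro!: AE_I2 prod_nonneg)

text \<open>A single term of the exponential series bounds \<open>(1 + r)\<^sup>N\<close> by \<open>N! exp (1 + r)\<close>, and
\<open>1 + r - r\<^sup>2 \<le> 5/4\<close>.\<close>

lemma power_times_gaussian_bounded:
  fixes r :: real
  assumes "0 \<le> r"
  shows "(1 + r) ^ N * exp (- r\<^sup>2) \<le> fact N * exp 2"
proof -
  have "(1 + r) ^ N / fact N \<le> exp (1 + r)"
    using sum_le_suminf[OF summable_exp_generic, of "{N}" "1 + r"] assms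
    by (simp add: exp_def divide_inverse mult.commute)
  then have "(1 + r) ^ N \<le> fact N * exp (1 + r)"
    by (simp add: field_simps)
  then have "(1 + r) ^ N * exp (- r\<^sup>2) \<le> fact N * exp (1 + r) * exp (- r\<^sup>2)"
    by (intro mult_right_mono) auto
  also have "\<dots> = fact N * exp (1 + r - r\<^sup>2)"
    by (simp add: exp_add[symmetric] mult.assoc)
  also have "1 + r - r\<^sup>2 \<le> 2"
    using zero_le_power2[of "r - 1/2"] by (simp add: power2_eq_square algebra_simps)
  then have "fact N * exp (1 + r - r\<^sup>2) \<le> fact N * exp 2" by simp
  finally show ?thesis .
qed

lemma confinement_exponent_le: "confinement_exponent (z :: complex ^ 'n) \<le> - (norm z)\<^sup>2"
proof -
  have "(norm z)\<^sup>2 = (\<Sum>k\<in>UNIV. (cmod (z $ k))\<^sup>2)"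
    by (simp add: norm_vec_def L2_set_def sum_nonneg)
  moreover have "1 * (norm z)\<^sup>2 \<le> real CARD('n) * (norm z)\<^sup>2"
    by (intro mult_right_mono) (auto simp: Suc_le_eq)
  ultimately show ?thesis by (simp add: confinement_exponent_def)
qed

lemma gas_weight_times_power_bounded:
  "\<exists>C>0. \<forall>z :: complex ^ 'n::{finite,linorder}. gas_weight z * (1 + norm z) ^ N \<le> C"
proof -
  let ?Q = "{(j :: 'n, k). j < k}"
  have factor: "(cmod (z $ j - z $ k))\<^sup>2 \<le> 4 * (1 + norm z) ^ 2" for z :: "complex ^ 'n::{finite,linorder}" and j k
  proof -
    have "cmod (z $ j - z $ k) \<le> 2 * (1 + norm z)"
      using norm_triangle_ineq4[of "z $ j" "z $ k"] Finite_Cartesian_Product.norm_nth_le[of z j] Finite_Cartesian_Product.norm_nth_le[of z k] by simp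
    then have "(cmod (z $ j - z $ k))\<^sup>2 \<le> (2 * (1 + norm z))\<^sup>2" by (rule power_mono) simp
    also have "\<dots> = 4 * (1 + norm z) ^ 2" by (simp only: power_mult_distrib) simp
    finally show ?thesis .
  qed
  have "gas_weight z * (1 + norm z) ^ N \<le> 4 ^ card ?Q * (fact (2 * card ?Q + N) * exp 2)" for z :: "complex ^ 'n::{finite,linorder}"
  proof -
    have "(\<Prod>(j, k)\<in>?Q. (cmod (z $ j - z $ k))\<^sup>2) \<le> (\<Prod>q\<in>?Q. 4 * (1 + norm z) ^ 2)"
      by (intro prod_mono) (auto simp: factor)
    also have "\<dots> = 4 ^ card ?Q * (1 + norm z) ^ (2 * card ?Q)"
      by (simp add: power_mult_distrib power_mult)
    finally have "gas_weight z \<le> exp (- (norm z)\<^sup>2) * (4 ^ card ?Q * (1 + norm z) ^ (2 * card ?Q))"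
      unfolding gas_weight_def confinement_exponent_def[symmetric]
      using confinement_exponent_le[of z] by (intro mult_mono) (auto simp: case_prod_beta intro!: prod_nonneg)
    then have "gas_weight z * (1 + norm z) ^ N
        \<le> exp (- (norm z)\<^sup>2) * (4 ^ card ?Q * (1 + norm z) ^ (2 * card ?Q)) * (1 + norm z) ^ N"
      by (intro mult_right_mono) auto
    also have "\<dots> = 4 ^ card ?Q * ((1 + norm z) ^ (2 * card ?Q + N) * exp (- (norm z)\<^sup>2))"
      by (simp add: power_add)
    also have "\<dots> \<le> 4 ^ card ?Q * (fact (2 * card ?Q + N) * exp 2)"
      by (intro mult_left_mono power_times_gaussian_bounded) auto
    finally show ?thesis .
  qed
  moreover have "0 < 4 ^ card ?Q * (fact (2 * card ?Q + N) * exp (2::real))" by simp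
  ultimately show ?thesis by blast
qed

text \<open>The weight decays faster than any polynomial grows, in particular faster than
\<open>\<Prod>\<^sub>b 1 / (1 + x\<^sub>b\<^sup>2)\<close>, whose integral is a finite product of one-dimensional integrals.\<close>

lemma gas_weight_integrable_bound:
  fixes g :: "complex ^ 'n::{finite,linorder} \<Rightarrow> 'b::{banach,second_countable_topology}"
  assumes [measurable]: "g \<in> borel_measurable borel"
    and g: "\<And>z. norm (g z) \<le> K * (1 + norm z) ^ N"
  shows "integrable lborel (\<lambda>z. gas_weight z *\<^sub>R g z)"
proof -
  let ?d = "DIM((complex, 'n) vec)"
  let ?p = "\<lambda>z :: complex ^ 'n::{finite,linorder}. \<Prod>b\<in>Basis. 1 + (z \<bullet> b)\<^sup>2"
  obtain C where C: "C > 0" "\<And>z :: complex ^ 'n::{finite,linorder}. gas_weight z * (1 + norm z) ^ (N + 2 * ?d) \<le> C"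
    using gas_weight_times_power_bounded[of "N + 2 * ?d"] by blast
  have "0 \<le> K" using order_trans[OF norm_ge_zero g[of 0]] by simp
  have p: "?p z \<le> (1 + norm z) ^ (2 * ?d)" for z
  proof -
    have "?p z \<le> (\<Prod>b\<in>(Basis :: (complex ^ 'n::{finite,linorder}) set). (1 + norm z) ^ 2)"
    proof (intro prod_mono conjI)
      fix b :: "complex ^ 'n::{finite,linorder}" assume "b \<in> Basis"
      then have "\<bar>z \<bullet> b\<bar> \<le> norm z" by (rule Basis_le_norm)
      then have "(z \<bullet> b)\<^sup>2 \<le> (norm z)\<^sup>2" by (metis abs_ge_zero power2_abs power_mono)
      then show "1 + (z \<bullet> b)\<^sup>2 \<le> (1 + norm z) ^ 2" by (simp add: power2_sum add_increasing2)
    qed simp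
    then show ?thesis by (simp only: prod_constant power_mult)
  qed
  have p_pos: "0 < ?p z" for z by (intro prod_pos) (simp add: add_pos_nonneg)
  have "norm (gas_weight z *\<^sub>R g z) \<le> (K * C) * (\<Prod>b\<in>Basis. inverse (1 + (z \<bullet> b)\<^sup>2))" for z
  proof -
    have "norm (gas_weight z *\<^sub>R g z) * ?p z \<le> (gas_weight z * (K * (1 + norm z) ^ N)) * (1 + norm z) ^ (2 * ?d)"
      using p[of z] p_pos[of z] g[of z] gas_weight_nonneg[of z] \<open>0 \<le> K\<close>
      by (intro mult_mono) (auto intro!: mult_left_mono mult_nonneg_nonneg)
    also have "\<dots> = K * (gas_weight z * (1 + norm z) ^ (N + 2 * ?d))"
      by (simp add: power_add)
    also have "\<dots> \<le> K * C" by (intro mult_left_mono C \<open>0 \<le> K\<close>)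
    finally have "norm (gas_weight z *\<^sub>R g z) \<le> K * C * inverse (?p z)"
      using p_pos[of z] by (simp add: field_simps)
    then show ?thesis using prod_inversef[of "\<lambda>b. 1 + (z \<bullet> b)\<^sup>2" Basis] by (simp add: o_def)
  qed
  note bound = this
  show ?thesis
  proof (rule Bochner_Integration.integrable_bound)
    show "integrable lborel (\<lambda>z :: complex ^ 'n::{finite,linorder}. (K * C) * (\<Prod>b\<in>Basis. inverse (1 + (z \<bullet> b)\<^sup>2)))"
      by (intro integrable_mult_right integrable_prod_inverse)
    show "AE z in lborel. norm (gas_weight z *\<^sub>R g z) \<le> norm ((K * C) * (\<Prod>b\<in>Basis. inverse (1 + (z \<bullet> b)\<^sup>2)))"
      using order_trans[OF bound abs_ge_self] by (intro AE_I2) simp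
  qed measurable
qed

lemma gas_weight_integrable: "integrable lborel (gas_weight :: complex ^ 'n::{finite,linorder} \<Rightarrow> real)"
  using gas_weight_integrable_bound[of "\<lambda>_. 1 :: real" 1 0] by simp

definition poly_growth :: "('a::real_normed_vector \<Rightarrow> complex) \<Rightarrow> bool" where
  "poly_growth f \<longleftrightarrow> (\<exists>K N. \<forall>z. cmod (f z) \<le> K * (1 + norm z) ^ N)"

lemma poly_growth_const: "poly_growth (\<lambda>_. c)"
  unfolding poly_growth_def by (rule exI[of _ "cmod c"], rule exI[of _ 0]) simp

lemma poly_growth_mult:
  assumes "poly_growth f" "poly_growth g" shows "poly_growth (\<lambda>z. f z * g z)"
proof -
  obtain K N K' N' where K: "\<And>z. cmod (f z) \<le> K * (1 + norm z) ^ N"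
    and K': "\<And>z. cmod (g z) \<le> K' * (1 + norm z) ^ N'"
    using assms by (auto simp: poly_growth_def)
  have "cmod (f z * g z) \<le> (K * K') * (1 + norm z) ^ (N + N')" for z
    using mult_mono[OF K[of z] K'[of z] order_trans[OF norm_ge_zero K[of z]] norm_ge_zero]
    by (simp add: norm_mult power_add mult_ac)
  then show ?thesis unfolding poly_growth_def by blast
qed

lemma poly_growth_power: "poly_growth f \<Longrightarrow> poly_growth (\<lambda>z. f z ^ k)"
  by (induction k) (auto intro: poly_growth_mult poly_growth_const)

section \<open>Normalization and integration against the gas measure\<close>

lemma continuous_integral_0_imp_0:
  fixes f :: "'a::euclidean_space \<Rightarrow> real"
  assumes cont: "continuous_on UNIV f" and int: "integrable lborel f"
    and nonneg: "\<And>x. 0 \<le> f x" and zero: "(\<integral>x. f x \<partial>lborel) = 0"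
  shows "f x = 0"
proof -
  have "AE x in lborel. f x = 0"
    using zero integral_nonneg_eq_0_iff_AE[OF int] nonneg by simp
  moreover have op: "open {x. f x \<noteq> 0}"
    using cont by (intro open_Collect_neq) auto
  ultimately have null: "{x. f x \<noteq> 0} \<in> null_sets lborel"
    by (subst AE_iff_null_sets) auto
  show ?thesis
  proof (rule ccontr)
    assume "f x \<noteq> 0"
    then have "x \<in> {x. f x \<noteq> 0}" by simp
    from open_contains_box[OF op this]
    obtain l u where sub: "box l u \<subseteq> {x. f x \<noteq> 0}" and box: "x \<in> box l u" .
    have "emeasure lborel (box l u) = 0"
      using null_sets_subset[OF null _ sub] by (simp add: null_setsD1)
    moreover have "0 < (\<Prod>b\<in>Basis. (u - l) \<bullet> b)"
      using box by (intro prod_pos) (force simp: mem_box inner_diff_left)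
    ultimately show False
      using box by (auto simp: mem_box emeasure_lborel_box_eq split: if_splits)
  qed
qed

text \<open>The coordinates are the ranks of the indices: distinct, so that the weight is positive, and
positive, so that the center of mass does not vanish.\<close>

definition separated_point :: "complex ^ 'n::{finite,linorder}" where
  "separated_point = (\<chi> j. of_nat (card {i. i \<le> j}))"

lemma gas_weight_separated_point: "0 < gas_weight (separated_point :: complex ^ 'n::{finite,linorder})"
proof -
  have "card {i. i \<le> j} < card {i. i \<le> k}" if "j < k" for j k :: 'n
    using that by (intro psubset_card_mono) (use that in \<open>auto simp: psubset_eq set_eq_iff not_le[symmetric] intro: less_imp_le\<close>)
  then have "separated_point $ j \<noteq> (separated_point :: complex ^ 'n::{finite,linorder}) $ k" if "j < k" for j k
    using that by (fastforce simp: separated_point_def)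
  then show ?thesis
    by (auto simp: gas_weight_def case_prod_beta intro!: mult_pos_pos prod_pos)
qed

text \<open>The normalizing constant depends on the number of particles only, so it takes the index type as
its argument.\<close>

definition partition_function :: "'n::{finite,linorder} itself \<Rightarrow> real" where
  "partition_function _ = (\<integral>w. gas_weight (w :: complex ^ 'n::{finite,linorder}) \<partial>lborel)"

lemma partition_function_pos: "0 < partition_function TYPE('n::{finite,linorder})"
proof -
  have "partition_function TYPE('n) \<noteq> 0"
    using continuous_integral_0_imp_0[OF gas_weight_continuous gas_weight_integrable gas_weight_nonneg]
      gas_weight_separated_point[where 'n = 'n]
    unfolding partition_function_def by (metis less_irrefl)
  moreover have "0 \<le> partition_function TYPE('n)"
    unfolding partition_function_def by (simp add: gas_weight_nonneg)
  ultimately show ?thesis by simp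
qed

lemma gas_measure_density:
  "(gas_measure :: (complex ^ 'n::{finite,linorder}) measure) =
    density lborel (\<lambda>z. ennreal (gas_weight z / partition_function TYPE('n)))"
  by (simp add: gas_measure_def partition_function_def)

lemma sets_gas_measure [simp, measurable_cong]: "sets gas_measure = sets borel"
  and space_gas_measure [simp]: "space gas_measure = UNIV"
  by (simp_all add: gas_measure_def)

lemma borel_measurable_gas_measure [simp]: "borel_measurable gas_measure = borel_measurable borel"
  by (rule measurable_cong_sets) simp_all

lemma integrable_gas_measure_iff:
  fixes g :: "complex ^ 'n::{finite,linorder} \<Rightarrow> 'b::{banach,second_countable_topology}"
  assumes [measurable]: "g \<in> borel_measurable borel"
  shows "integrable gas_measure g \<longleftrightarrow> integrable lborel (\<lambda>z. gas_weight z *\<^sub>R g z)"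
proof -
  have "integrable gas_measure g \<longleftrightarrow>
      integrable lborel (\<lambda>z. inverse (partition_function TYPE('n)) *\<^sub>R (gas_weight z *\<^sub>R g z))"
    unfolding gas_measure_density using partition_function_pos[where 'n = 'n]
    by (subst integrable_density) (auto simp: gas_weight_nonneg divide_inverse mult.commute less_imp_le)
  then show ?thesis
    using partition_function_pos[where 'n = 'n]
      integrable_scaleR_right[of "partition_function TYPE('n)" lborel
        "\<lambda>z. inverse (partition_function TYPE('n)) *\<^sub>R (gas_weight z *\<^sub>R g z)"]
    by (auto simp del: scaleR_scaleR simp: scaleR_scaleR[of "partition_function TYPE('n)"] intro: integrable_scaleR_right)
qed

lemma integral_gas_measure:
  fixes g :: "complex ^ 'n::{finite,linorder} \<Rightarrow> 'b::{banach,second_countable_topology}"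
  assumes [measurable]: "g \<in> borel_measurable borel"
  shows "(\<integral>z. g z \<partial>gas_measure) =
    inverse (partition_function TYPE('n)) *\<^sub>R (\<integral>z. gas_weight z *\<^sub>R g z \<partial>lborel)"
proof -
  have "(\<integral>z. g z \<partial>gas_measure) =
      (\<integral>z. inverse (partition_function TYPE('n)) *\<^sub>R (gas_weight z *\<^sub>R g z) \<partial>lborel)"
    unfolding gas_measure_density using partition_function_pos[where 'n = 'n]
    by (subst integral_density) (auto simp: gas_weight_nonneg divide_inverse mult.commute less_imp_le)
  then show ?thesis by (simp del: scaleR_scaleR)
qed

lemma AE_gas_measure_iff:
  fixes P :: "complex ^ 'n::{finite,linorder} \<Rightarrow> bool"
  shows "(AE z in gas_measure. P z) \<longleftrightarrow> (AE z in lborel. gas_weight z \<noteq> 0 \<longrightarrow> P z)"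
  unfolding gas_measure_density using partition_function_pos[where 'n = 'n]
  by (subst AE_density) (auto simp: gas_weight_nonneg less_le zero_less_divide_iff)

lemma poly_growth_integrable:
  fixes g :: "complex ^ 'n::{finite,linorder} \<Rightarrow> 'b::{banach,second_countable_topology}"
  assumes "g \<in> borel_measurable borel" "\<And>z. norm (g z) \<le> K * (1 + norm z) ^ N"
  shows "integrable gas_measure g"
  using gas_weight_integrable_bound[OF assms] assms(1) by (simp add: integrable_gas_measure_iff)

lemma poly_growth_L2:
  assumes f: "f \<in> borel_measurable borel" and "poly_growth f"
  shows "f \<in> L2 gas_measure"
proof -
  obtain K N where K: "\<And>z. cmod (f z) \<le> K * (1 + norm z) ^ N"
    using assms(2) by (auto simp: poly_growth_def)
  have "norm ((cmod (f z))\<^sup>2) \<le> K\<^sup>2 * (1 + norm z) ^ (N * 2)" for z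
    using power_mono[OF K norm_ge_zero, of z 2] by (simp add: power_mult_distrib power_mult)
  then have "integrable gas_measure (\<lambda>z. (cmod (f z))\<^sup>2)"
    using f by (intro poly_growth_integrable) auto
  then show ?thesis using f by (simp add: L2_def)
qed

lemma test_functions_L2:
  assumes "f \<in> test_functions" shows "f \<in> L2 gas_measure"
proof -
  obtain C where "\<And>z. cmod (f z) \<le> C" using test_functions_bounded[OF assms] by blast
  then have "poly_growth f" unfolding poly_growth_def by (intro exI[of _ C] exI[of _ 0]) simp
  then show ?thesis using poly_growth_L2 test_functions_measurable[OF assms] by blast
qed

section \<open>Closability of the gradient\<close>

text \<open>Integrate \<open>\<phi>\<close> by parts against \<open>\<eta> w\<close> times the density \<open>w\<close> for test functions \<open>\<phi>\<close>: the
derivative of \<open>\<eta> w\<^sup>2\<close> is \<open>w (w \<partial>\<eta> + 2 \<eta> \<partial>w)\<close>, so a factor \<open>w\<close> is left for the measure, and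
dividing by \<open>w\<close> creates no singularity. Both sides are then pairings with functions in
\<open>L\<^sup>2\<close>, and they pass to the limit that defines \<open>G\<close>.\<close>

lemma weak_gradient:
  fixes f :: "complex ^ 'n::{finite,linorder} \<Rightarrow> complex"
  assumes fG: "has_H1_gradient gas_measure f G" and \<eta>: "\<eta> \<in> test_functions" and b: "b \<in> Basis"
  shows "(\<integral>z. G b z * (\<eta> z * cweight z) \<partial>gas_measure) =
    - (\<integral>z. f z * (grad \<eta> b z * cweight z + \<eta> z * (2 * grad cweight b z)) \<partial>gas_measure)"
proof -
  have f: "f \<in> L2 gas_measure" and G: "G b \<in> L2 gas_measure"
    using fG b by (auto simp: has_H1_gradient_def)
  note \<eta>' = test_functions_smooth[OF \<eta>]
  obtain \<phi> where \<phi>: "\<And>i::nat. \<phi> i \<in> test_functions"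
    and lim: "(\<lambda>i. L2_norm gas_measure (\<lambda>x. \<phi> i x - f x)) \<longlonglongrightarrow> 0"
    and lim_grad: "\<And>b. b \<in> Basis \<Longrightarrow> (\<lambda>i. L2_norm gas_measure (\<lambda>x. grad (\<phi> i) b x - G b x)) \<longlonglongrightarrow> 0"
    by (rule has_H1_gradient_approx[OF fG]) blast
  let ?L = "\<lambda>z. \<eta> z * cweight z"
  let ?M = "\<lambda>z. grad \<eta> b z * cweight z + \<eta> z * (2 * grad cweight b z)"
  have L: "?L \<in> test_functions" by (intro test_functions_mult \<eta> smooth_gas_weight)
  have M: "?M \<in> test_functions"
    by (rule test_functions_add; rule test_functions_mult)
       (rule test_functions_grad[OF \<eta> b] \<eta> smooth_gas_weight
         smooth_mult[OF smooth_const smooth_grad[OF smooth_gas_weight b]])+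
  have "grad ?L b = (\<lambda>z. \<eta> z * grad cweight b z + grad \<eta> b z * cweight z)"
    by (rule grad_mult; rule smooth_differentiable; rule \<eta>' smooth_gas_weight)
  moreover have "grad (\<lambda>z. ?L z * cweight z) b = (\<lambda>z. ?L z * grad cweight b z + grad ?L b z * cweight z)"
    by (rule grad_mult; rule smooth_differentiable; rule test_functions_smooth[OF L] smooth_gas_weight)
  ultimately have "grad (\<lambda>z. ?L z * cweight z) b = (\<lambda>z. cweight z * ?M z)"
    by (simp add: fun_eq_iff algebra_simps)
  note product = this
  have parts: "(\<integral>z. grad u b z * ?L z \<partial>gas_measure) = - (\<integral>z. u z * ?M z \<partial>gas_measure)"
    if u: "u \<in> test_functions" for u
  proof -
    have meas: "(\<lambda>z. grad u b z * ?L z) \<in> borel_measurable borel" "(\<lambda>z. u z * ?M z) \<in> borel_measurable borel"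
      by (intro borel_measurable_times test_functions_measurable L M u test_functions_grad[OF u b])+
    have "(\<integral>z. gas_weight z *\<^sub>R (grad u b z * ?L z) \<partial>lborel) = (\<integral>z. grad u b z * (?L z * cweight z) \<partial>lborel)"
      by (simp only: scaleR_conv_of_real mult_ac)
    also have "\<dots> = - (\<integral>z. u z * (cweight z * ?M z) \<partial>lborel)"
      using integration_by_parts[OF u smooth_mult[OF test_functions_smooth[OF L] smooth_gas_weight] b]
      unfolding product .
    also have "\<dots> = - (\<integral>z. gas_weight z *\<^sub>R (u z * ?M z) \<partial>lborel)"
      by (simp only: scaleR_conv_of_real mult.left_commute)
    finally show ?thesis
      by (simp only: integral_gas_measure[OF meas(1)] integral_gas_measure[OF meas(2)] scaleR_minus_right)
  qed
  have "(\<lambda>i. \<integral>z. grad (\<phi> i) b z * ?L z \<partial>gas_measure) \<longlonglongrightarrow> (\<integral>z. G b z * ?L z \<partial>gas_measure)"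
    by (intro L2_limit test_functions_L2 test_functions_grad \<phi> b G L lim_grad)
  moreover have "(\<lambda>i. - (\<integral>z. \<phi> i z * ?M z \<partial>gas_measure)) \<longlonglongrightarrow> - (\<integral>z. f z * ?M z \<partial>gas_measure)"
    by (intro tendsto_minus L2_limit test_functions_L2 \<phi> f M lim)
  ultimately show ?thesis
    using LIMSEQ_unique by (simp add: parts[OF \<phi>])
qed

text \<open>By \<open>weak_gradient\<close>, the difference \<open>D\<close> of the two gradients satisfies \<open>\<integral> \<eta> w\<^sup>2 D = 0\<close>, an integral
over Lebesgue measure, for all test functions \<open>\<eta>\<close>. Hence \<open>w\<^sup>2 D = 0\<close> almost everywhere, which says
that \<open>D = 0\<close> almost everywhere with respect to the gas measure.\<close>

lemma H1_gradient_unique: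
  fixes f :: "complex ^ 'n::{finite,linorder} \<Rightarrow> complex"
  assumes G: "has_H1_gradient gas_measure f G" and G': "has_H1_gradient gas_measure f G'"
    and b: "b \<in> Basis"
  shows "AE z in gas_measure. G b z = G' b z"
proof -
  let ?D = "\<lambda>z. G b z - G' b z"
  have L2: "G b \<in> L2 gas_measure" "G' b \<in> L2 gas_measure"
    using G G' b by (auto simp: has_H1_gradient_def)
  have D: "?D \<in> L2 gas_measure" by (intro L2_diff L2)
  have D_meas [measurable]: "?D \<in> borel_measurable borel"
    using L2_measurable[OF D] by simp
  have "(\<lambda>_. 1) \<in> L2 (gas_measure :: (complex ^ 'n::{finite,linorder}) measure)"
    by (rule poly_growth_L2) (simp, unfold poly_growth_def, rule exI[of _ 1], rule exI[of _ 0], simp)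
  from L2_mult_integrable(1)[OF D this]
  have int: "integrable lborel (\<lambda>z. cweight z * ?D z)"
    by (simp add: integrable_gas_measure_iff scaleR_conv_of_real)
  obtain C where C: "\<And>z :: complex ^ 'n::{finite,linorder}. gas_weight z \<le> C"
    using gas_weight_times_power_bounded[where N = 0 and 'n = 'n]
    by (metis mult_1_right power_0)
  \<comment> \<open>One factor of the weight comes from the gas measure; the other is bounded.\<close>
  have int2: "integrable lborel (\<lambda>z. cweight z * (cweight z * ?D z))"
  proof (rule Bochner_Integration.integrable_bound)
    show "integrable lborel (\<lambda>z. complex_of_real C * (cweight z * ?D z))"
      using int by (rule integrable_mult_right)
    show "AE z in lborel. cmod (cweight z * (cweight z * ?D z)) \<le> cmod (complex_of_real C * (cweight z * ?D z))"
      using order_trans[OF C abs_ge_self]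
      by (intro AE_I2) (auto simp: norm_mult abs_of_nonneg[OF gas_weight_nonneg]
          intro!: mult_right_mono mult_nonneg_nonneg gas_weight_nonneg)
  qed measurable
  have "AE z in lborel. cweight z * (cweight z * ?D z) = 0"
  proof (rule fundamental_lemma_calculus_of_variations[OF int2])
    fix \<eta> :: "complex ^ 'n::{finite,linorder} \<Rightarrow> complex" assume \<eta>: "\<eta> \<in> test_functions"
    note [measurable] = test_functions_measurable[OF \<eta>]
    have \<eta>W: "(\<lambda>z. \<eta> z * cweight z) \<in> L2 gas_measure"
      by (intro test_functions_L2 test_functions_mult \<eta> smooth_gas_weight)
    have "(\<integral>z. ?D z * (\<eta> z * cweight z) \<partial>gas_measure) = 0"
      using weak_gradient[OF G \<eta> b] weak_gradient[OF G' \<eta> b]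
        L2_mult_integrable(1)[OF L2(1) \<eta>W] L2_mult_integrable(1)[OF L2(2) \<eta>W]
      by (simp add: left_diff_distrib)
    then have "(\<integral>z. gas_weight z *\<^sub>R (?D z * (\<eta> z * cweight z)) \<partial>lborel) = 0"
      using partition_function_pos[where 'n = 'n] by (subst (asm) integral_gas_measure) auto
    then show "(\<integral>z. \<eta> z * (cweight z * (cweight z * ?D z)) \<partial>lborel) = 0"
      by (simp add: scaleR_conv_of_real mult_ac)
  qed
  then show ?thesis
    unfolding AE_gas_measure_iff by eventually_elim auto
qed

section \<open>Smooth functions of polynomial growth belong to the Sobolev space\<close>

text \<open>Equal to \<open>exp (1 - 1 / (1 - \<bar>x\<bar>\<^sup>2 / R\<^sup>2))\<close> inside the ball of radius \<open>R = n + 1\<close> and zero outside. What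
makes it work in \<open>H\<^sup>1\<close> is that it lies between zero and one, tends to one pointwise, and has a
gradient that tends to zero.\<close>

definition cutoff :: "nat \<Rightarrow> 'a::euclidean_space \<Rightarrow> real" where
  "cutoff n x = exp 1 * flat 1 (1 - (x \<bullet> x) / (real (Suc n))\<^sup>2)"

lemma cutoff_profile_smooth:
  "smooth (\<lambda>x::'a::euclidean_space. complex_of_real (1 - (x \<bullet> x) / c))"
proof -
  have eq: "(\<lambda>x::'a. complex_of_real (1 - (x \<bullet> x) / c)) =
    (\<lambda>x. 1 - (\<Sum>b\<in>Basis. complex_of_real (x \<bullet> b) * complex_of_real (x \<bullet> b)) * complex_of_real (1 / c))"
    by (rule ext, subst euclidean_inner) simp
  show ?thesis unfolding eq
    by (intro smooth_diff smooth_mult smooth_sum smooth_const smooth_coordinate)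
qed

lemma grad_cutoff_profile:
  assumes "c \<noteq> 0"
  shows "grad (\<lambda>x::'a::euclidean_space. complex_of_real (1 - (x \<bullet> x) / c)) b x =
    complex_of_real (- (2 * (x \<bullet> b)) / c)"
  using assms by (intro grad_eqI) (auto intro!: derivative_eq_intros simp: inner_commute)

lemma cutoff_test_function: "(\<lambda>x. complex_of_real (cutoff n x)) \<in> test_functions"
proof -
  have "smooth (\<lambda>x::'a. complex_of_real (cutoff n x))"
    unfolding cutoff_def of_real_mult
    by (intro smooth_mult smooth_const smooth_flat cutoff_profile_smooth)
  moreover have "cutoff n x = 0" if "real (Suc n) < norm x" for x :: 'a
  proof -
    have "(real (Suc n))\<^sup>2 < x \<bullet> x"
      using that by (simp only: power2_norm_eq_inner[symmetric]) (rule power_strict_mono, auto)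
    then have "1 - (x \<bullet> x) / (real (Suc n))\<^sup>2 \<le> 0" by (simp add: field_simps del: of_nat_Suc)
    then show ?thesis by (simp add: cutoff_def flat_one(3) del: of_nat_Suc)
  qed
  ultimately show ?thesis by (auto simp: test_functions_iff)
qed

lemma cutoff_bounds: "0 \<le> cutoff n x" "cutoff n x \<le> 1"
proof -
  show "0 \<le> cutoff n x" by (simp add: cutoff_def flat_one)
  let ?t = "1 - (x \<bullet> x) / (real (Suc n))\<^sup>2"
  have "?t \<le> 1" by simp
  then have "1 \<le> 1 / ?t" if "?t > 0" using that by (simp add: field_simps)
  then have "exp 1 * exp (- (1 / ?t)) \<le> 1" if "?t > 0"
    using that by (simp add: exp_add[symmetric])
  then show "cutoff n x \<le> 1" by (simp add: cutoff_def flat_def)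
qed

lemma cutoff_argument_tendsto: "(\<lambda>n. y / (real (Suc n))\<^sup>2) \<longlonglongrightarrow> 0"
proof -
  have "(\<lambda>n. y * (inverse (real (Suc n)))\<^sup>2) \<longlonglongrightarrow> y * 0\<^sup>2"
    by (intro tendsto_intros LIMSEQ_inverse_real_of_nat)
  then show ?thesis by (simp add: divide_inverse power_inverse del: of_nat_Suc)
qed

lemma cutoff_tendsto: "(\<lambda>n. cutoff n x) \<longlonglongrightarrow> 1"
proof -
  have "(\<lambda>n. flat 1 (1 - (x \<bullet> x) / (real (Suc n))\<^sup>2)) \<longlonglongrightarrow> flat 1 (1 - 0)"
    by (intro isCont_tendsto_compose[OF DERIV_isCont[OF flat_has_derivative]]
        tendsto_diff tendsto_const cutoff_argument_tendsto)
  from tendsto_mult_left[OF this, of "exp 1"] show ?thesis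
    by (simp add: cutoff_def flat_def exp_minus)
qed

lemma grad_cutoff_bound:
  "\<exists>D. \<forall>n (x::'a::euclidean_space). \<forall>b\<in>Basis.
    cmod (grad (\<lambda>x. complex_of_real (cutoff n x)) b x) \<le> D * (norm x / (real (Suc n))\<^sup>2)"
proof -
  have "bounded (flat (flat_deriv 1) ` {0..1})"
    by (intro compact_imp_bounded compact_continuous_image flat_continuous) simp
  then obtain D where D: "D > 0" "\<And>t. t \<in> {0..1} \<Longrightarrow> \<bar>flat (flat_deriv 1) t\<bar> \<le> D"
    by (auto simp: bounded_pos)
  then have D': "\<bar>flat (flat_deriv 1) t\<bar> \<le> D" if "t \<le> 1" for t
    using that by (cases "t \<ge> 0") (auto simp: flat_def)
  have "cmod (grad (\<lambda>x. complex_of_real (cutoff n x)) b x) \<le> exp 1 * D * 2 * (norm x / (real (Suc n))\<^sup>2)"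
    if b: "b \<in> Basis" for n and x b :: 'a
  proof -
    let ?c = "(real (Suc n))\<^sup>2"
    let ?p = "\<lambda>x::'a. 1 - (x \<bullet> x) / ?c"
    have "grad (\<lambda>x. complex_of_real (cutoff n x)) b x =
        complex_of_real (exp 1) * (complex_of_real (flat (flat_deriv 1) (?p x)) * complex_of_real (- (2 * (x \<bullet> b)) / ?c))"
      unfolding cutoff_def of_real_mult
        grad_mult[OF smooth_differentiable[OF smooth_const] smooth_differentiable[OF smooth_flat(1)[OF cutoff_profile_smooth]]]
        smooth_flat(2)[OF cutoff_profile_smooth] grad_const
      by (subst grad_cutoff_profile) auto
    then have "cmod (grad (\<lambda>x. complex_of_real (cutoff n x)) b x) =
        exp 1 * (\<bar>flat (flat_deriv 1) (?p x)\<bar> * (2 * \<bar>x \<bullet> b\<bar> / ?c))"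
      by (simp only: norm_mult norm_of_real) (simp add: abs_mult)
    also have "\<dots> \<le> exp 1 * (D * (2 * norm x / ?c))"
      using Basis_le_norm[OF b, of x] D(1)
      by (intro mult_left_mono mult_mono D' divide_right_mono) auto
    finally show ?thesis by (simp add: mult_ac)
  qed
  then show ?thesis by blast
qed

lemma L2_norm_tendsto_0:
  fixes u :: "nat \<Rightarrow> complex ^ 'n::{finite,linorder} \<Rightarrow> complex"
  assumes meas [measurable]: "\<And>i. u i \<in> borel_measurable borel"
    and bound: "\<And>i z. cmod (u i z) \<le> K * (1 + norm z) ^ N"
    and lim: "\<And>z. (\<lambda>i. u i z) \<longlonglongrightarrow> 0"
  shows "(\<lambda>i. L2_norm gas_measure (u i)) \<longlonglongrightarrow> 0"
proof -
  have "(\<lambda>i. \<integral>z. (cmod (u i z))\<^sup>2 \<partial>gas_measure) \<longlonglongrightarrow> (\<integral>z. 0 \<partial>(gas_measure :: (complex ^ 'n::{finite,linorder}) measure))"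
  proof (rule integral_dominated_convergence)
    show "integrable gas_measure (\<lambda>z :: complex ^ 'n::{finite,linorder}. K\<^sup>2 * (1 + norm z) ^ (N * 2))"
      by (intro poly_growth_integrable[of _ "K\<^sup>2" "N * 2"]) auto
    show "AE z in gas_measure. (\<lambda>i. (cmod (u i z))\<^sup>2) \<longlonglongrightarrow> 0"
      using tendsto_power[OF tendsto_norm_zero[OF lim], of _ 2] by (intro AE_I2) simp
    show "AE z in gas_measure. norm ((cmod (u i z))\<^sup>2) \<le> K\<^sup>2 * (1 + norm z) ^ (N * 2)" for i
      using power_mono[OF bound norm_ge_zero, of i _ 2]
      by (intro AE_I2) (simp add: power_mult_distrib power_mult)
  qed auto
  from tendsto_real_sqrt[OF this] show ?thesis by (simp add: L2_norm_def)
qed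

text \<open>The products of \<open>f\<close> with the cutoffs are test functions, and dominated convergence shows that they
and their gradients converge, since functions of polynomial growth are square integrable.\<close>

lemma has_H1_gradient_poly_growth:
  fixes f :: "complex ^ 'n::{finite,linorder} \<Rightarrow> complex"
  assumes smooth: "smooth f" and f: "poly_growth f"
    and grad: "\<And>b. b \<in> Basis \<Longrightarrow> poly_growth (grad f b)"
  shows "has_H1_gradient gas_measure f (grad f)"
proof -
  have meas [measurable]: "g \<in> borel_measurable borel" if "smooth g" for g :: "complex ^ 'n::{finite,linorder} \<Rightarrow> complex"
    by (rule borel_measurable_continuous_onI[OF smooth_continuous[OF that]])
  let ?c = "\<lambda>n (z :: complex ^ 'n::{finite,linorder}). complex_of_real (cutoff n z)"
  define \<phi> where "\<phi> n z = ?c n z * f z" for n z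
  have c_smooth: "smooth (?c n)" for n by (rule test_functions_smooth[OF cutoff_test_function])
  have c_near: "cmod (?c n z - 1) \<le> 1" for n z
  proof -
    have "cmod (complex_of_real (cutoff n z - 1)) \<le> 1"
      using cutoff_bounds[of n z] unfolding norm_of_real by simp
    then show ?thesis by simp
  qed
  have c_lim: "(\<lambda>n. ?c n z - 1) \<longlonglongrightarrow> 0" for z
    using tendsto_of_real[OF cutoff_tendsto, of z] LIM_zero by fastforce
  obtain K N where K: "\<And>z. cmod (f z) \<le> K * (1 + norm z) ^ N"
    using f by (auto simp: poly_growth_def)
  obtain D where D: "\<And>n z b. b \<in> Basis \<Longrightarrow> cmod (grad (?c n) b z) \<le> D * (norm z / (real (Suc n))\<^sup>2)"
    using grad_cutoff_bound by metis
  \<comment> \<open>The difference is at most the modulus of the function itself and tends to zero pointwise.\<close>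
  have convergence: "(\<lambda>n. L2_norm gas_measure (\<lambda>z. \<phi> n z - f z)) \<longlonglongrightarrow> 0"
  proof (rule L2_norm_tendsto_0)
    show "(\<lambda>z. \<phi> n z - f z) \<in> borel_measurable borel" for n
      unfolding \<phi>_def using smooth c_smooth by measurable
    have eq: "\<phi> n z - f z = (?c n z - 1) * f z" for n z by (simp add: \<phi>_def algebra_simps)
    show "cmod (\<phi> n z - f z) \<le> K * (1 + norm z) ^ N" for n z
      using mult_mono[OF c_near[of n z] K[of z]] by (simp add: eq norm_mult)
    show "(\<lambda>n. \<phi> n z - f z) \<longlonglongrightarrow> 0" for z
      unfolding eq using tendsto_mult_left_zero[OF c_lim] .
  qed
  have gradients: "(\<lambda>n. L2_norm gas_measure (\<lambda>z. grad (\<phi> n) b z - grad f b z)) \<longlonglongrightarrow> 0"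
    if b: "b \<in> Basis" for b
  proof -
    have eq: "grad (\<phi> n) b z - grad f b z = (?c n z - 1) * grad f b z + grad (?c n) b z * f z" for n z
      unfolding \<phi>_def grad_mult[OF smooth_differentiable[OF c_smooth] smooth_differentiable[OF smooth]]
      by (simp add: algebra_simps)
    obtain K' N' where K': "\<And>z. cmod (grad f b z) \<le> K' * (1 + norm z) ^ N'"
      using grad[OF b] by (auto simp: poly_growth_def)
    have "0 \<le> K" "0 \<le> K'" using order_trans[OF norm_ge_zero K[of 0]] order_trans[OF norm_ge_zero K'[of 0]] by auto
    show ?thesis
    proof (rule L2_norm_tendsto_0)
      show "(\<lambda>z. grad (\<phi> n) b z - grad f b z) \<in> borel_measurable borel" for n
        unfolding eq using smooth c_smooth smooth_grad[OF smooth b] smooth_grad[OF c_smooth b] by measurable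
      \<comment> \<open>Both terms of the product rule are dominated by the larger power; the extra factor
        \<open>1 + norm z\<close> absorbs the gradient of the cutoff.\<close>
      show "cmod (grad (\<phi> n) b z - grad f b z) \<le> (K' + \<bar>D\<bar> * K) * (1 + norm z) ^ (N' + Suc N)" for n z
      proof -
        let ?r = "1 + norm z"
        have "cmod ((?c n z - 1) * grad f b z) \<le> K' * ?r ^ N'"
          using mult_mono[OF c_near[of n z] K'[of z]] by (simp add: norm_mult)
        also have "\<dots> \<le> K' * ?r ^ (N' + Suc N)"
          by (intro mult_left_mono power_increasing \<open>0 \<le> K'\<close>) auto
        finally have 1: "cmod ((?c n z - 1) * grad f b z) \<le> K' * ?r ^ (N' + Suc N)" .
        have "norm z / (real (Suc n))\<^sup>2 \<le> norm z / 1"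
          by (intro divide_left_mono) (auto simp del: of_nat_Suc intro!: one_le_power) 
        then have "D * (norm z / (real (Suc n))\<^sup>2) \<le> \<bar>D\<bar> * ?r"
          by (intro mult_mono) auto
        with D[OF b, of n z] have "cmod (grad (?c n) b z) \<le> \<bar>D\<bar> * ?r" by linarith
        from mult_mono[OF this K[of z]] have "cmod (grad (?c n) b z * f z) \<le> (\<bar>D\<bar> * K) * ?r ^ Suc N"
          by (simp add: norm_mult mult_ac)
        also have "\<dots> \<le> (\<bar>D\<bar> * K) * ?r ^ (N' + Suc N)"
          using \<open>0 \<le> K\<close> by (intro mult_left_mono power_increasing) auto
        finally have 2: "cmod (grad (?c n) b z * f z) \<le> (\<bar>D\<bar> * K) * ?r ^ (N' + Suc N)" .
        show ?thesis unfolding eq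
          using norm_triangle_ineq[of "(?c n z - 1) * grad f b z" "grad (?c n) b z * f z"] 1 2
          by (simp add: distrib_right)
      qed
      show "(\<lambda>n. grad (\<phi> n) b z - grad f b z) \<longlonglongrightarrow> 0" for z
      proof -
        have "(\<lambda>n. D * (norm z / (real (Suc n))\<^sup>2)) \<longlonglongrightarrow> 0"
          using tendsto_mult_right_zero[OF cutoff_argument_tendsto] .
        then have "(\<lambda>n. grad (?c n) b z) \<longlonglongrightarrow> 0"
          by (rule Lim_null_comparison[rotated]) (use D[OF b] in auto)
        from tendsto_add[OF tendsto_mult_left_zero[OF c_lim] tendsto_mult_left_zero[OF this]]
        show ?thesis unfolding eq by simp
      qed
    qed
  qed
  have "(\<lambda>n. sqrt ((L2_norm gas_measure (\<lambda>z. \<phi> n z - f z))\<^sup>2 +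
      (\<Sum>b\<in>Basis. (L2_norm gas_measure (\<lambda>z. grad (\<phi> n) b z - grad f b z))\<^sup>2)))
    \<longlonglongrightarrow> sqrt (0\<^sup>2 + (\<Sum>b\<in>(Basis :: (complex ^ 'n::{finite,linorder}) set). 0\<^sup>2))"
    by (intro tendsto_intros convergence gradients)
  moreover have "\<phi> n \<in> test_functions" for n
    unfolding \<phi>_def by (intro test_functions_mult cutoff_test_function smooth)
  ultimately show ?thesis
    unfolding has_H1_gradient_def
    using poly_growth_L2[OF meas[OF smooth] f] poly_growth_L2[OF meas[OF smooth_grad[OF smooth]] grad]
    by (auto intro!: exI[of _ \<phi>])
qed

section \<open>The center of mass\<close>

definition center :: "complex ^ 'n \<Rightarrow> complex" where
  "center z = (\<Sum>j\<in>UNIV. z $ j)"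

lemma bounded_linear_center: "bounded_linear center"
  unfolding center_def by (intro bounded_linear_sum bounded_linear_vec_nth)

lemma center_axis: "center (axis j c) = c"
  by (simp add: center_def axis_def if_distrib cong: if_cong)

lemma smooth_center: "smooth center"
  by (intro smooth_linear bounded_linear_center)

lemma cnj_center: "cnj (center z) = (\<Sum>j\<in>UNIV. cnj (z $ j))"
  by (simp add: center_def)

lemma smooth_cnj_center: "smooth (\<lambda>z. cnj (center z))"
  unfolding cnj_center by (intro smooth_sum smooth_cnj_component)

lemma poly_growth_center: "poly_growth (center :: complex ^ 'n \<Rightarrow> complex)"
proof -
  have "cmod (center z) \<le> real CARD('n) * (1 + norm z) ^ 1" for z :: "complex ^ 'n"
  proof -
    have "cmod (center z) \<le> (\<Sum>j\<in>(UNIV :: 'n set). norm z)"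
      unfolding center_def by (intro sum_norm_le Finite_Cartesian_Product.norm_nth_le)
    then show ?thesis by (simp add: distrib_left)
  qed
  then show ?thesis unfolding poly_growth_def by blast
qed

lemma sum_Basis_complex_vec:
  "(\<Sum>b\<in>(Basis :: (complex ^ 'n) set). F b) = (\<Sum>j\<in>UNIV. F (axis j 1) + F (axis j \<i>))"
proof -
  have Basis: "(Basis :: (complex ^ 'n) set) = (\<lambda>(j, c). axis j c) ` (UNIV \<times> {1, \<i>})"
    by (auto simp: Basis_vec_def Basis_complex_def)
  have inj: "inj_on (\<lambda>(j :: 'n, c). axis j c) (UNIV \<times> {1, \<i>})"
    by (auto simp: inj_on_def axis_eq_axis)
  have "(\<Sum>b\<in>(Basis :: (complex ^ 'n) set). F b) = (\<Sum>(j, c)\<in>UNIV \<times> {1, \<i>}. F (axis j c))"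
    unfolding Basis sum.reindex[OF inj] by (simp add: case_prod_beta)
  also have "\<dots> = (\<Sum>j\<in>UNIV. \<Sum>c\<in>{1, \<i>}. F (axis j c))"
    by (rule sum.cartesian_product[symmetric])
  finally show ?thesis by simp
qed

lemma axis_component: "axis i c $ j = (if i = j then c else 0)"
  by (simp add: axis_def)

section \<open>The derivation dual to the center of mass\<close>

text \<open>For \<open>b\<close> equal to \<open>axis j 1\<close> or \<open>axis j \<i>\<close>, the coefficient is \<open>1\<close> or \<open>- \<i>\<close>; so this is
\<open>\<Sum>j. \<partial>/\<partial>x\<^sub>j - \<i> \<partial>/\<partial>y\<^sub>j\<close>, twice the sum of the Wirtinger derivatives \<open>\<partial>/\<partial>z\<^sub>j\<close>. Pairing the
gradient of \<open>f\<close> with the conjugate gradient of \<open>S\<^sup>k\<close> gives \<open>k (cnj S)\<^bsup>k - 1\<^esup>\<close> times this derivation.\<close>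

definition wirtinger :: "(complex ^ 'n \<Rightarrow> complex) \<Rightarrow> complex ^ 'n \<Rightarrow> complex" where
  "wirtinger f z = (\<Sum>b\<in>Basis. cnj (center b) * grad f b z)"

lemma wirtinger_mult:
  assumes "smooth f" "smooth g"
  shows "wirtinger (\<lambda>z. f z * g z) z = f z * wirtinger g z + wirtinger f z * g z"
  using assms
  by (simp add: wirtinger_def grad_mult smooth_differentiable algebra_simps sum.distrib
      sum_distrib_left sum_distrib_right)

lemma wirtinger_add:
  assumes "smooth f" "smooth g"
  shows "wirtinger (\<lambda>z. f z + g z) z = wirtinger f z + wirtinger g z"
  using assms
  by (simp add: wirtinger_def grad_add smooth_differentiable algebra_simps sum.distrib)

lemma wirtinger_const: "wirtinger (\<lambda>_. c) z = 0"
  by (simp add: wirtinger_def grad_const)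

lemma wirtinger_sum:
  assumes "\<And>i. i \<in> I \<Longrightarrow> smooth (f i)"
  shows "wirtinger (\<lambda>z. \<Sum>i\<in>I. f i z) z = (\<Sum>i\<in>I. wirtinger (f i) z)"
  using assms
  by (induction I rule: infinite_finite_induct) (auto simp: wirtinger_const wirtinger_add smooth_sum)

lemma wirtinger_component: "wirtinger (\<lambda>z. z $ j) z = 2"
proof -
  have "wirtinger (\<lambda>z. z $ j) z = (\<Sum>b\<in>Basis. cnj (center b) * b $ j)"
    unfolding wirtinger_def by (subst grad_linear[OF bounded_linear_vec_nth]) simp
  also have "\<dots> = (\<Sum>i\<in>UNIV. if i = j then 2 else 0)"
    unfolding sum_Basis_complex_vec by (intro sum.cong refl) (auto simp: center_axis axis_component)
  finally show ?thesis by simp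
qed

lemma wirtinger_cnj_component: "wirtinger (\<lambda>z. cnj (z $ j)) z = 0"
proof -
  have "wirtinger (\<lambda>z. cnj (z $ j)) z = (\<Sum>b\<in>Basis. cnj (center b) * cnj (b $ j))"
    unfolding wirtinger_def
    by (subst grad_linear[OF bounded_linear_compose[OF bounded_linear_cnj bounded_linear_vec_nth]]) simp
  also have "\<dots> = 0"
    unfolding sum_Basis_complex_vec by (intro sum.neutral ballI) (auto simp: center_axis axis_component)
  finally show ?thesis .
qed

lemma wirtinger_diff:
  assumes "smooth f" "smooth g"
  shows "wirtinger (\<lambda>z. f z - g z) z = wirtinger f z - wirtinger g z"
  using wirtinger_add[OF assms(1) smooth_mult[OF smooth_const assms(2)], of "-1" z]
    wirtinger_mult[OF smooth_const assms(2), of "-1" z]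
  by (simp add: wirtinger_const)

lemma wirtinger_prod_eq_0:
  assumes "\<And>i. i \<in> I \<Longrightarrow> smooth (f i)" "\<And>i. i \<in> I \<Longrightarrow> wirtinger (f i) z = 0"
  shows "wirtinger (\<lambda>z. \<Prod>i\<in>I. f i z) z = 0"
  using assms
  by (induction I rule: infinite_finite_induct) (auto simp: wirtinger_const wirtinger_mult smooth_prod)

text \<open>The derivation takes the same value on all coordinates and vanishes on their conjugates, so it
annihilates every factor: this is the translation invariance of the interaction.\<close>

lemma wirtinger_vandermonde_sq: "wirtinger vandermonde_sq z = 0"
proof -
  have factor: "wirtinger (\<lambda>z. (z $ j - z $ k) * (cnj (z $ j) - cnj (z $ k))) z = 0" for j k
    by (subst wirtinger_mult)
       (auto simp: wirtinger_diff smooth_diff smooth_component smooth_cnj_component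
         wirtinger_component wirtinger_cnj_component)
  show ?thesis
    unfolding vandermonde_sq_def[abs_def] case_prod_beta
    by (rule wirtinger_prod_eq_0)
       (auto simp: factor intro!: smooth_mult smooth_diff smooth_component smooth_cnj_component)
qed

lemma wirtinger_cnj_center_power: "wirtinger (\<lambda>z. cnj (center z) ^ m) z = 0"
proof (induction m)
  case (Suc m)
  have "wirtinger (\<lambda>z. cnj (center z)) z = 0"
    unfolding cnj_center
    by (subst wirtinger_sum) (auto simp: wirtinger_cnj_component smooth_cnj_component)
  with Suc show ?case by (simp add: wirtinger_mult smooth_cnj_center smooth_power)
qed (simp add: wirtinger_const)

lemma wirtinger_confinement_exponent:
  "wirtinger (\<lambda>z :: complex ^ 'n. complex_of_real (confinement_exponent z)) z = - (2 * of_nat CARD('n)) * cnj (center z)"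
proof -
  have sq: "smooth (\<lambda>z :: complex ^ 'n. z $ k * cnj (z $ k))" for k
    by (intro smooth_mult smooth_component smooth_cnj_component)
  have "wirtinger (\<lambda>z :: complex ^ 'n. \<Sum>k\<in>UNIV. z $ k * cnj (z $ k)) z = 2 * cnj (center z)"
    by (simp add: wirtinger_sum sq wirtinger_mult smooth_component smooth_cnj_component
        wirtinger_component wirtinger_cnj_component center_def sum_distrib_left)
  then show ?thesis
    unfolding of_real_confinement_exponent wirtinger_mult[OF smooth_const smooth_sum[OF sq]]
    by (simp add: wirtinger_const)
qed

lemma wirtinger_gas_weight:
  "wirtinger cweight (z :: complex ^ 'n::{finite,linorder}) =
    - (2 * of_nat CARD('n)) * cnj (center z) * cweight z"
proof -
  have "wirtinger (\<lambda>z. complex_of_real (exp (confinement_exponent z))) z =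
      complex_of_real (exp (confinement_exponent z)) * wirtinger (\<lambda>z. complex_of_real (confinement_exponent z)) z"
    by (simp add: wirtinger_def smooth_exp(2)[OF smooth_confinement_exponent] sum_distrib_left mult_ac)
  then show ?thesis
    unfolding of_real_gas_weight
    by (simp add: wirtinger_mult[OF smooth_exp(1)[OF smooth_confinement_exponent] smooth_vandermonde_sq]
        wirtinger_vandermonde_sq wirtinger_confinement_exponent)
qed

lemma integral_wirtinger_test_function:
  assumes u: "u \<in> test_functions"
  shows "(\<integral>z. wirtinger u z \<partial>lborel) = 0"
  unfolding wirtinger_def
  using test_functions_integrable[OF test_functions_grad[OF u]] integral_grad_test_function[OF u]
  by (subst Bochner_Integration.integral_sum) auto

text \<open>Apply \<open>integral_wirtinger_test_function\<close> to \<open>u (cnj S)\<^sup>m w\<close>. The power of \<open>cnj S\<close> is annihilated, and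
\<open>w\<close> contributes the factor \<open>- 2 n (cnj S)\<close>, which raises the power by one.\<close>

lemma integration_by_parts_wirtinger:
  fixes u :: "complex ^ 'n::{finite,linorder} \<Rightarrow> complex"
  assumes u: "u \<in> test_functions"
  shows "(\<integral>z. wirtinger u z * cnj (center z) ^ m \<partial>gas_measure) =
    2 * of_nat CARD('n) * (\<integral>z. u z * cnj (center z) ^ Suc m \<partial>gas_measure)"
proof -
  let ?S = "\<lambda>z :: complex ^ 'n::{finite,linorder}. cnj (center z)"
  let ?v = "\<lambda>z. ?S z ^ m * cweight z"
  have Sm: "smooth (\<lambda>z. ?S z ^ k)" for k by (intro smooth_power smooth_cnj_center)
  have v: "smooth ?v" by (intro smooth_mult Sm smooth_gas_weight)
  have du: "wirtinger u = (\<lambda>z. \<Sum>b\<in>Basis. grad u b z * cnj (center b))"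
    by (simp add: wirtinger_def fun_eq_iff mult.commute)
  have du_meas: "wirtinger u \<in> borel_measurable borel"
    unfolding du
    by (intro borel_measurable_sum borel_measurable_times borel_measurable_const
        test_functions_measurable test_functions_grad u)
  have S_meas: "(\<lambda>z. ?S z ^ k) \<in> borel_measurable borel" for k
    by (intro borel_measurable_continuous_onI smooth_continuous Sm)
  have meas: "(\<lambda>z. wirtinger u z * ?S z ^ m) \<in> borel_measurable borel"
    "(\<lambda>z. u z * ?S z ^ Suc m) \<in> borel_measurable borel"
    by (intro borel_measurable_times du_meas S_meas test_functions_measurable u)+
  have prod: "wirtinger (\<lambda>z. u z * ?v z) z =
      wirtinger u z * ?v z - 2 * of_nat CARD('n) * (u z * (?S z ^ Suc m * cweight z))" for z
    unfolding wirtinger_mult[OF test_functions_smooth[OF u] v] wirtinger_mult[OF Sm smooth_gas_weight]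
      wirtinger_cnj_center_power wirtinger_gas_weight
    by (simp add: algebra_simps)
  have i1: "integrable lborel (\<lambda>z. u z * (?S z ^ Suc m * cweight z))"
    by (intro test_functions_integrable test_functions_mult u smooth_mult Sm smooth_gas_weight)
  have i2: "integrable lborel (\<lambda>z. wirtinger u z * ?v z)"
    unfolding du sum_distrib_right mult.assoc
    by (intro Bochner_Integration.integrable_sum test_functions_integrable test_functions_mult test_functions_grad
        u smooth_mult[OF smooth_const v])
  have "(\<integral>z. wirtinger u z * ?v z \<partial>lborel) = 2 * of_nat CARD('n) * (\<integral>z. u z * (?S z ^ Suc m * cweight z) \<partial>lborel)"
    using integral_wirtinger_test_function[OF test_functions_mult[OF u v]] i1 i2
    by (simp add: prod del: power_Suc)
  then have "(\<integral>z. gas_weight z *\<^sub>R (wirtinger u z * ?S z ^ m) \<partial>lborel) =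
      2 * of_nat CARD('n) * (\<integral>z. gas_weight z *\<^sub>R (u z * ?S z ^ Suc m) \<partial>lborel)"
    by (simp add: scaleR_conv_of_real mult_ac del: power_Suc)
  then show ?thesis
    by (simp only: integral_gas_measure[OF meas(1)] integral_gas_measure[OF meas(2)] mult_scaleR_right)
qed

section \<open>Powers of the center of mass and the spectrum\<close>

definition center_power :: "nat \<Rightarrow> complex ^ 'n \<Rightarrow> complex" where
  "center_power k z = center z ^ k"

lemma smooth_center_power: "smooth (center_power k)"
  unfolding center_power_def[abs_def] by (intro smooth_power smooth_center)

lemma grad_center_power: "grad (center_power k) b z = of_nat k * center z ^ (k - 1) * center b"
proof -
  have "(center has_derivative center) (at z)"
    by (rule bounded_linear_imp_has_derivative[OF bounded_linear_center])
  from has_derivative_power[OF this, of k] show ?thesis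
    unfolding center_power_def[abs_def] by (subst grad_eqI) (auto simp: mult_ac)
qed

lemma poly_growth_center_power: "poly_growth (center_power k)"
  unfolding center_power_def[abs_def] by (intro poly_growth_power poly_growth_center)

lemma poly_growth_grad_center_power: "poly_growth (grad (center_power k) b)"
  unfolding grad_center_power[abs_def]
  by (intro poly_growth_mult poly_growth_power poly_growth_center poly_growth_const)

lemma has_H1_gradient_center_power:
  "has_H1_gradient gas_measure (center_power k :: complex ^ 'n::{finite,linorder} \<Rightarrow> complex) (grad (center_power k))"
  by (intro has_H1_gradient_poly_growth smooth_center_power poly_growth_center_power poly_growth_grad_center_power)

text \<open>The conjugate of the gradient of \<open>S\<^sup>k\<close> in direction \<open>b\<close> is \<open>k (cnj S)\<^bsup>k - 1\<^esup> cnj (S b)\<close>, so for a test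
function \<open>g\<close> this is \<open>integration_by_parts_wirtinger\<close> with \<open>m = k - 1\<close>; for \<open>k = 0\<close> both sides vanish. Both sides are continuous in the norm of
\<open>H\<^sup>1\<close>.\<close>

lemma integral_grad_center_power:
  fixes g :: "complex ^ 'n::{finite,linorder} \<Rightarrow> complex"
  assumes g: "has_H1_gradient gas_measure g G"
  shows "(\<integral>z. (\<Sum>b\<in>Basis. G b z * cnj (grad (center_power k) b z)) \<partial>gas_measure) =
    2 * of_nat CARD('n) * of_nat k * L2_inner gas_measure g (center_power k)"
proof -
  let ?f = "center_power k :: complex ^ 'n::{finite,linorder} \<Rightarrow> complex"
  have f_L2: "(\<lambda>z. cnj (?f z)) \<in> L2 gas_measure"
    and df_L2: "\<And>b. b \<in> Basis \<Longrightarrow> (\<lambda>z. cnj (grad ?f b z)) \<in> L2 gas_measure"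
    and g_L2: "g \<in> L2 gas_measure" and G_L2: "\<And>b. b \<in> Basis \<Longrightarrow> G b \<in> L2 gas_measure"
    using has_H1_gradient_center_power[of k, where 'n = 'n] g
    by (auto simp: has_H1_gradient_def intro!: L2_cnj)
  obtain \<phi> where \<phi>: "\<And>i::nat. \<phi> i \<in> test_functions"
    and lim: "(\<lambda>i. L2_norm gas_measure (\<lambda>x. \<phi> i x - g x)) \<longlonglongrightarrow> 0"
    and lim_grad: "\<And>b. b \<in> Basis \<Longrightarrow> (\<lambda>i. L2_norm gas_measure (\<lambda>x. grad (\<phi> i) b x - G b x)) \<longlonglongrightarrow> 0"
    by (rule has_H1_gradient_approx[OF g]) blast
  have test: "(\<Sum>b\<in>Basis. \<integral>z. grad u b z * cnj (grad ?f b z) \<partial>gas_measure) =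
      2 * of_nat CARD('n) * of_nat k * (\<integral>z. u z * cnj (?f z) \<partial>gas_measure)"
    if u: "u \<in> test_functions" for u
  proof -
    have "(\<Sum>b\<in>Basis. \<integral>z. grad u b z * cnj (grad ?f b z) \<partial>gas_measure) =
        (\<integral>z. (\<Sum>b\<in>Basis. grad u b z * cnj (grad ?f b z)) \<partial>gas_measure)"
      by (rule Bochner_Integration.integral_sum[symmetric])
         (intro L2_mult_integrable(1) test_functions_L2 test_functions_grad u df_L2)
    also have "\<dots> = (\<integral>z. of_nat k * (wirtinger u z * cnj (center z) ^ (k - 1)) \<partial>gas_measure)"
      by (simp add: wirtinger_def grad_center_power sum_distrib_left sum_distrib_right mult_ac)
    also have "\<dots> = of_nat k * (\<integral>z. wirtinger u z * cnj (center z) ^ (k - 1) \<partial>gas_measure)"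
      by simp
    also have "\<dots> = 2 * of_nat CARD('n) * of_nat k * (\<integral>z. u z * cnj (?f z) \<partial>gas_measure)"
      by (cases k) (simp_all add: integration_by_parts_wirtinger[OF u] center_power_def del: of_nat_Suc)
    finally show ?thesis .
  qed
  have "(\<lambda>i. \<Sum>b\<in>Basis. \<integral>z. grad (\<phi> i) b z * cnj (grad ?f b z) \<partial>gas_measure) \<longlonglongrightarrow>
      (\<Sum>b\<in>Basis. \<integral>z. G b z * cnj (grad ?f b z) \<partial>gas_measure)"
    by (intro tendsto_sum L2_limit test_functions_L2 test_functions_grad \<phi> G_L2 df_L2 lim_grad)
  moreover have "(\<lambda>i. 2 * of_nat CARD('n) * of_nat k * (\<integral>z. \<phi> i z * cnj (?f z) \<partial>gas_measure)) \<longlonglongrightarrow>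
      2 * of_nat CARD('n) * of_nat k * (\<integral>z. g z * cnj (?f z) \<partial>gas_measure)"
    by (intro tendsto_mult tendsto_const L2_limit test_functions_L2 \<phi> g_L2 f_L2 lim)
  ultimately have "(\<Sum>b\<in>Basis. \<integral>z. G b z * cnj (grad ?f b z) \<partial>gas_measure) =
      2 * of_nat CARD('n) * of_nat k * (\<integral>z. g z * cnj (?f z) \<partial>gas_measure)"
    using LIMSEQ_unique by (simp add: test[OF \<phi>])
  moreover have "(\<Sum>b\<in>Basis. \<integral>z. G b z * cnj (grad ?f b z) \<partial>gas_measure) =
      (\<integral>z. (\<Sum>b\<in>Basis. G b z * cnj (grad ?f b z)) \<partial>gas_measure)"
    by (rule Bochner_Integration.integral_sum[symmetric]) (intro L2_mult_integrable(1) G_L2 df_L2)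
  ultimately show ?thesis by (simp add: L2_inner_def)
qed

text \<open>The eigenvalue equation in weak form. The form is defined by an arbitrary choice of gradients, and
\<open>H1_gradient_unique\<close> replaces the one chosen for the power of \<open>S\<close> by the classical one.\<close>

lemma dirichlet_form_center_power:
  fixes g :: "complex ^ 'n::{finite,linorder} \<Rightarrow> complex"
  assumes "g \<in> H1 gas_measure"
  shows "dirichlet_form \<alpha> g (center_power k) =
    complex_of_real (2 * (\<alpha> / real CARD('n)) * real k) * L2_inner gas_measure g (center_power k)"
proof -
  let ?f = "center_power k :: complex ^ 'n::{finite,linorder} \<Rightarrow> complex"
  let ?G = "H1_grad gas_measure g" and ?F = "H1_grad gas_measure ?f"
  have G: "has_H1_gradient gas_measure g ?G" by (rule has_H1_gradient_H1_grad[OF assms])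
  have F: "has_H1_gradient gas_measure ?f ?F"
    using has_H1_gradient_center_power[of k, where 'n = 'n]
    by (intro has_H1_gradient_H1_grad) (auto simp: H1_def)
  have meas: "?G b \<in> borel_measurable gas_measure" "?F b \<in> borel_measurable gas_measure"
    "grad ?f b \<in> borel_measurable gas_measure" if "b \<in> Basis" for b
    using G F has_H1_gradient_center_power[of k, where 'n = 'n] that L2_measurable
    unfolding has_H1_gradient_def by metis+
  have "(\<integral>z. (\<Sum>b\<in>Basis. ?G b z * cnj (?F b z)) \<partial>gas_measure) =
      (\<integral>z. (\<Sum>b\<in>Basis. ?G b z * cnj (grad ?f b z)) \<partial>gas_measure)"
  proof (rule integral_cong_AE)
    have "AE z in gas_measure. \<forall>b\<in>Basis. ?F b z = grad ?f b z"
      using H1_gradient_unique[OF F has_H1_gradient_center_power]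
      by (intro AE_finite_allI) auto
    then show "AE z in gas_measure. (\<Sum>b\<in>Basis. ?G b z * cnj (?F b z)) = (\<Sum>b\<in>Basis. ?G b z * cnj (grad ?f b z))"
      by eventually_elim simp
    show "(\<lambda>z. \<Sum>b\<in>Basis. ?G b z * cnj (?F b z)) \<in> borel_measurable gas_measure"
      by (intro borel_measurable_sum borel_measurable_times borel_measurable_cnj meas)
    show "(\<lambda>z. \<Sum>b\<in>Basis. ?G b z * cnj (grad ?f b z)) \<in> borel_measurable gas_measure"
      by (intro borel_measurable_sum borel_measurable_times borel_measurable_cnj meas)
  qed
  then show ?thesis
    by (simp add: dirichlet_form_def integral_grad_center_power[OF G] power2_eq_square)
qed

lemma L2_inner_center_power_self:
  "L2_inner gas_measure (center_power k :: complex ^ 'n::{finite,linorder} \<Rightarrow> complex) (center_power k) \<noteq> 0"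
proof
  let ?f = "center_power k :: complex ^ 'n::{finite,linorder} \<Rightarrow> complex"
  let ?p = "separated_point :: complex ^ 'n::{finite,linorder}"
  assume zero: "L2_inner gas_measure ?f ?f = 0"
  have meas: "(\<lambda>z. (cmod (?f z))\<^sup>2) \<in> borel_measurable borel"
    by (intro borel_measurable_continuous_onI continuous_intros smooth_continuous smooth_center_power)
  have f_L2: "?f \<in> L2 gas_measure"
    using has_H1_gradient_center_power[of k, where 'n = 'n] by (simp add: has_H1_gradient_def)
  have "L2_inner gas_measure ?f ?f = complex_of_real (\<integral>z. (cmod (?f z))\<^sup>2 \<partial>gas_measure)"
    unfolding L2_inner_def complex_norm_square[symmetric] by (rule integral_complex_of_real)
  then have "(\<integral>z. gas_weight z *\<^sub>R (cmod (?f z))\<^sup>2 \<partial>lborel) = 0"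
    using zero partition_function_pos[where 'n = 'n] by (simp add: integral_gas_measure[OF meas])
  moreover have "integrable lborel (\<lambda>z. gas_weight z *\<^sub>R (cmod (?f z))\<^sup>2)"
    using L2_integrable[OF f_L2] by (simp only: integrable_gas_measure_iff[OF meas])
  moreover have "continuous_on UNIV (\<lambda>z. gas_weight z *\<^sub>R (cmod (?f z))\<^sup>2)"
    by (intro continuous_intros gas_weight_continuous smooth_continuous smooth_center_power)
  ultimately have "gas_weight ?p *\<^sub>R (cmod (?f ?p))\<^sup>2 = 0"
    using continuous_integral_0_imp_0[of "\<lambda>z. gas_weight z *\<^sub>R (cmod (?f z))\<^sup>2" ?p]
    by (simp add: gas_weight_nonneg)
  then have "center ?p = 0"
    using gas_weight_separated_point[where 'n = 'n] by (auto simp: center_power_def)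
  moreover have "center ?p = of_nat (\<Sum>j\<in>(UNIV :: 'n set). card {i. i \<le> j})"
    by (simp add: center_def separated_point_def)
  moreover have "0 < (\<Sum>j\<in>(UNIV :: 'n set). card {i. i \<le> j})"
    by (intro sum_pos) (auto simp: card_gt_0_iff)
  ultimately show False by (simp only: of_nat_eq_0_iff)
qed

theorem corollary1p5:
  fixes \<alpha> :: real
  assumes "\<alpha> > 0"
  shows "{complex_of_real (- 2 * (\<alpha> / real CARD('n)) * real k) | k :: nat. True}
    \<subseteq> spectrum (gas_measure :: (complex ^ 'n::{finite,linorder}) measure)
        (generator_domain \<alpha>) (generator \<alpha>)"
proof safe
  fix k :: nat
  let ?M = "gas_measure :: (complex ^ 'n::{finite,linorder}) measure"
  let ?\<zeta> = "complex_of_real (- 2 * (\<alpha> / real CARD('n)) * real k)"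
  let ?f = "center_power k :: complex ^ 'n::{finite,linorder} \<Rightarrow> complex"
  have f: "?f \<in> L2 ?M" "?f \<in> H1 ?M"
    using has_H1_gradient_center_power[of k, where 'n = 'n] by (auto simp: has_H1_gradient_def H1_def)
  have "?\<zeta> \<notin> resolvent_set ?M (generator_domain \<alpha>) (generator \<alpha>)"
  proof
    assume "?\<zeta> \<in> resolvent_set ?M (generator_domain \<alpha>) (generator \<alpha>)"
    then obtain g where g: "g \<in> generator_domain \<alpha>"
      and eq: "AE z in ?M. ?\<zeta> * g z - generator \<alpha> g z = ?f z"
      using f(1) by (auto simp: resolvent_set_def)
    let ?a = "generator \<alpha> g"
    have "is_generator_value \<alpha> g ?a"
      using g someI_ex[of "is_generator_value \<alpha> g"]
      unfolding generator_def generator_domain_def by blast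
    then have a: "?a \<in> L2 ?M" and pair: "- L2_inner ?M ?a ?f = dirichlet_form \<alpha> g ?f"
      using f(2) by (auto simp: is_generator_value_def)
    have gH1: "g \<in> H1 ?M" using g by (simp add: generator_domain_def)
    then have gL2: "g \<in> L2 ?M" by (auto simp: H1_def has_H1_gradient_def)
    note int = L2_mult_integrable(1)[OF _ L2_cnj[OF f(1)]]
    have "L2_inner ?M ?f ?f = (\<integral>z. (?\<zeta> * g z - ?a z) * cnj (?f z) \<partial>?M)"
      unfolding L2_inner_def
    proof (rule integral_cong_AE)
      show "AE z in ?M. ?f z * cnj (?f z) = (?\<zeta> * g z - ?a z) * cnj (?f z)"
        using eq by eventually_elim simp
    qed (intro borel_measurable_times borel_measurable_diff borel_measurable_cnj borel_measurable_const
          L2_measurable f a gL2)+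
    also have "\<dots> = ?\<zeta> * L2_inner ?M g ?f - L2_inner ?M ?a ?f"
      unfolding L2_inner_def left_diff_distrib mult.assoc using int[OF a] int[OF gL2] by simp
    also have "\<dots> = 0"
      using pair[symmetric] by (simp add: dirichlet_form_center_power[OF gH1])
    finally show False using L2_inner_center_power_self by blast
  qed
  then show "?\<zeta> \<in> spectrum ?M (generator_domain \<alpha>) (generator \<alpha>)"
    by (simp add: spectrum_def)
qed

end
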